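(* Let $r>0$, $1<M<e^r$, and let $J\in\mathcal B_r$ be an interaction on $\mathcal L=\mathbb Z^d$ satisfying the high temperature condition $$\|J\|_r\le \frac{\log(M)\,c^2}{2s\,(c+\log(M))},\qquad c=\frac{1}{\sqrt{\epsilon}}-1,\quad \epsilon=Me^{-r}.$$ Then for every finite subset $W$ of the original lattice $\mathcal L$ and every finite subset $Z$ of the image lattice $\mathcal L'$, the partial derivative of the renormalization group transformation in infinite volume, $$\frac{\partial J'(Z)}{\partial J(W)}=\sum_{\sigma'}\sigma'_Z\,\frac{\sum_{R,\Delta'}\tilde w_R\prod_{N\in\Delta'}w_N}{\sum_{\Delta}\prod_{N\in\Delta}w_N},$$ is well-defined.
   Context: Lattices and blocks: $\mathcal L=\mathbb Z^d$ is partitioned into blocks $y^o$, all of the same finite cardinality $s$, indexed by $y\in\mathcal L'$. Spins: $\sigma\in\{\pm1\}^{\mathcal L}$, $\sigma'\in\{\pm1\}^{\mathcal L'}$; $\sigma_X=\prod_{x\in X}\sigma_x$, $\sigma'_Z=\prod_{z\in Z}\sigma'_z$. The symbols $\sum_\sigma$ and $\sum_{\sigma'}$ are normalized sums, i.e. expectation with respect to the product of uniform probability measures on $\{\pm1\}$. Kernel: for each $y\in\mathcal L'$, $T_y(\sigma,\sigma'_y)\ge 0$ depends on $\sigma$ only through the restriction of $\sigma$ to $y^o$, with $T_y(\sigma,\sigma'_y)=T_y(-\sigma,-\sigma'_y)$ and $\sum_{\sigma'}T_y(\sigma,\sigma'_y)=1$ for all $\sigma,y$; consequently $\sum_\sigma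 T_y(\sigma,\pm1)=1$. Interactions: $J$ assigns a real number $J(X)$ to each nonempty finite $X\subset\mathcal L$; $\mathcal B_r$ is the Banach space of such $J$ with $\|J\|_r=\sup_{x\in\mathcal L}\sum_{X:\,x\in X}|J(X)|e^{r|X|}<\infty$. Hypergraphs: a hypergraph $\Gamma$ is a finite collection of nonempty finite subsets (links) of $\mathcal L$. Two links are block-connected if they both intersect some common block. A nonempty $\Gamma$ is block-connected if it cannot be split into two nonempty subcollections such that no link of one is block-connected to a link of the other; every $\Gamma$ splits uniquely into block-connected components. For $X\subset\mathcal L$, $X'\subset\mathcal L'$ is the set of $y$ with $y^o\cap X\ne\emptyset$; $\Gamma^*=\bigcup_{X\in\Gamma}X'$. Weights: for nonempty finite $N\subset\mathcal L'$, $w_N=\sum_{\Gamma_c}\sum_\sigma\prod_{y\in N}T_y(\sigma,\sigma'_y)\prod_{X\in\Gamma_c}(e^{J(X)\sigma_X}-1)$, summing over block-connected hypergraphs $\Gamma_c$ with $\Gamma_c^*=N$. For finite $R\subset\mathcal L'$ with $R=\emptyset$ or $R\cap W'\ne\emptyset$, $\tilde w_R=\sum_{\Gamma}\sum_\sigma\sigma_W\prod_{y\in R\cup W'}T_y(\sigma,\sigma'_y)\prod_{X\in\Gamma}(e^{J(X)\sigma_X}-1)$, summing over hypergraphs $\Gamma$ with $\Gamma^*=R$ such that every block-connected component $\Gamma_i$ of $\Gamma$ satisfies $\Gamma_i^*\cap W'\neq\emptyset$ (for $R=\emptyset$ only $\Gamma=\emptyset$). These weights depend on $\sigma'$. In the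 formula, $R$ ranges over such sets, $\Delta'$ over sets of pairwise disjoint nonempty subsets of $\mathcal L'\setminus(R\cup W')$, and $\Delta$ over sets of pairwise disjoint nonempty subsets of $\mathcal L'$. In infinite volume, for each $R$ the ratio $\sum_{\Delta'}\prod_{N\in\Delta'}w_N/\sum_\Delta\prod_{N\in\Delta}w_N$ is interpreted as $$\exp\Big(-\sum_{p\ge1}\tfrac1{p!}\sum_{N_1,\dots,N_p}C(N_1,\dots,N_p)\,c(R\cup W',\textstyle\bigcup_iN_i)\,w_{N_1}\cdots w_{N_p}\Big),$$ where $c(A,B)=1$ if $A\cap B\ne\emptyset$ and $0$ otherwise, $C(N_1,\dots,N_p)=\sum_{G_c}\prod_{\{i,j\}\in G_c}(-c(N_i,N_j))$ over connected graphs $G_c$ on vertex set $\{1,\dots,p\}$, and $N_i$ range over nonempty finite subsets of $\mathcal L'$. (The constant $c$ is distinct from the function $c(\cdot,\cdot)$.) "Well-defined" means: for every $\sigma'$ the series in each exponent converges absolutely, the sum over $R$ of $\tilde w_R$ times these ratios converges absolutely, and the result is an integrable function of $\sigma'$. *)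

theory Defs
  imports "HOL-Probability.Probability" "HOL-Library.Disjoint_Sets"
begin

text \<open>The original lattice is the type \<open>int ^ 'd\<close>; the image lattice is an arbitrary
  index type \<open>'b\<close>, and \<open>block y\<close> is the block indexed by \<open>y\<close>.\<close>

definition block_partition :: "('b \<Rightarrow> (int ^ 'd) set) \<Rightarrow> nat \<Rightarrow> bool" where
  "block_partition block s \<longleftrightarrow>
     partition_on UNIV (range block) \<and> inj block \<and>
     (\<forall>y. finite (block y) \<and> card (block y) = s)"

text \<open>Spin configurations are the points of \<open>space spin_measure\<close>, i.e. the functions with
  values in \<open>{-1, 1}\<close>. Normalized sums over configurations, on either lattice, are integrals
  with respect to this measure.\<close>

definition spin_measure :: "('x \<Rightarrow> real) measure" where
  "spin_measure = PiM UNIV (\<lambda>_. uniform_count_measure {-1, 1})"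

definition spin_prod :: "('x \<Rightarrow> real) \<Rightarrow> 'x set \<Rightarrow> real" where
  "spin_prod \<sigma> X = (\<Prod>x\<in>X. \<sigma> x)"

definition rg_kernel ::
    "('b \<Rightarrow> (int ^ 'd) set) \<Rightarrow> ('b \<Rightarrow> (int ^ 'd \<Rightarrow> real) \<Rightarrow> real \<Rightarrow> real) \<Rightarrow> bool" where
  "rg_kernel block T \<longleftrightarrow>
     (\<forall>y. \<forall>\<sigma>\<in>space spin_measure. \<forall>t\<in>{-1, 1}. T y \<sigma> t \<ge> 0) \<and>
     (\<forall>y. \<forall>\<sigma>\<in>space spin_measure. \<forall>\<tau>\<in>space spin_measure. \<forall>t\<in>{-1, 1}.
        (\<forall>x\<in>block y. \<sigma> x = \<tau> x) \<longrightarrow> T y \<sigma> t = T y \<tau> t) \<and>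
     (\<forall>y. \<forall>\<sigma>\<in>space spin_measure. \<forall>t\<in>{-1, 1}. T y \<sigma> t = T y (\<lambda>x. - \<sigma> x) (- t)) \<and>
     (\<forall>y. \<forall>\<sigma>\<in>space spin_measure. (\<integral>\<sigma>'. T y \<sigma> (\<sigma>' y) \<partial>spin_measure) = 1)"

text \<open>An interaction is a function on all sets of sites, of which only the values at nonempty
  finite sets are ever used. The norm is extended-valued.\<close>

definition interaction_norm :: "real \<Rightarrow> ((int ^ 'd) set \<Rightarrow> real) \<Rightarrow> ennreal" where
  "interaction_norm r J =
     (SUP x. \<Sum>\<^sub>\<infinity>X\<in>{X. finite X \<and> x \<in> X}. ennreal (\<bar>J X\<bar> * exp (r * real (card X))))"

definition interaction_space :: "real \<Rightarrow> ((int ^ 'd) set \<Rightarrow> real) set" where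
  "interaction_space r = {J. interaction_norm r J < \<infinity>}"

definition hypergraph :: "(int ^ 'd) set set \<Rightarrow> bool" where
  "hypergraph \<Gamma> \<longleftrightarrow> finite \<Gamma> \<and> (\<forall>X\<in>\<Gamma>. finite X \<and> X \<noteq> {})"

definition links_connected ::
    "('b \<Rightarrow> (int ^ 'd) set) \<Rightarrow> (int ^ 'd) set \<Rightarrow> (int ^ 'd) set \<Rightarrow> bool" where
  "links_connected block X Y \<longleftrightarrow> (\<exists>y. X \<inter> block y \<noteq> {} \<and> Y \<inter> block y \<noteq> {})"

definition block_connected :: "('b \<Rightarrow> (int ^ 'd) set) \<Rightarrow> (int ^ 'd) set set \<Rightarrow> bool" where
  "block_connected block \<Gamma> \<longleftrightarrow>
     \<Gamma> \<noteq> {} \<and>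
     \<not> (\<exists>\<Gamma>1 \<Gamma>2. \<Gamma>1 \<noteq> {} \<and> \<Gamma>2 \<noteq> {} \<and> \<Gamma>1 \<union> \<Gamma>2 = \<Gamma> \<and> \<Gamma>1 \<inter> \<Gamma>2 = {} \<and>
          (\<forall>X\<in>\<Gamma>1. \<forall>Y\<in>\<Gamma>2. \<not> links_connected block X Y))"

definition block_components ::
    "('b \<Rightarrow> (int ^ 'd) set) \<Rightarrow> (int ^ 'd) set set \<Rightarrow> (int ^ 'd) set set set" where
  "block_components block \<Gamma> =
     {\<Gamma>1. \<Gamma>1 \<subseteq> \<Gamma> \<and> block_connected block \<Gamma>1 \<and>
          (\<forall>X\<in>\<Gamma>1. \<forall>Y\<in>\<Gamma> - \<Gamma>1. \<not> links_connected block X Y)}"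

text \<open>\<open>image_set block X\<close> is $X'$ and \<open>image_support block \<Gamma>\<close> is $\Gamma^*$.\<close>

definition image_set :: "('b \<Rightarrow> (int ^ 'd) set) \<Rightarrow> (int ^ 'd) set \<Rightarrow> 'b set" where
  "image_set block X = {y. block y \<inter> X \<noteq> {}}"

definition image_support :: "('b \<Rightarrow> (int ^ 'd) set) \<Rightarrow> (int ^ 'd) set set \<Rightarrow> 'b set" where
  "image_support block \<Gamma> = (\<Union>X\<in>\<Gamma>. image_set block X)"

text \<open>The weights $w_N$ and $\tilde w_R$. Blocks being finite, only finitely many hypergraphs have
  a given finite support, so the sums over hypergraphs below are genuine finite sums.\<close>

definition weight ::
    "('b \<Rightarrow> (int ^ 'd) set) \<Rightarrow> ('b \<Rightarrow> (int ^ 'd \<Rightarrow> real) \<Rightarrow> real \<Rightarrow> real) \<Rightarrow>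
     ((int ^ 'd) set \<Rightarrow> real) \<Rightarrow> ('b \<Rightarrow> real) \<Rightarrow> 'b set \<Rightarrow> real" where
  "weight block T J \<sigma>' N =
     (\<Sum>\<Gamma> | hypergraph \<Gamma> \<and> block_connected block \<Gamma> \<and> image_support block \<Gamma> = N.
        \<integral>\<sigma>. (\<Prod>y\<in>N. T y \<sigma> (\<sigma>' y)) * (\<Prod>X\<in>\<Gamma>. exp (J X * spin_prod \<sigma> X) - 1) \<partial>spin_measure)"

definition marked_weight ::
    "('b \<Rightarrow> (int ^ 'd) set) \<Rightarrow> ('b \<Rightarrow> (int ^ 'd \<Rightarrow> real) \<Rightarrow> real \<Rightarrow> real) \<Rightarrow>
     ((int ^ 'd) set \<Rightarrow> real) \<Rightarrow> (int ^ 'd) set \<Rightarrow> ('b \<Rightarrow> real) \<Rightarrow> 'b set \<Rightarrow> real" where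
  "marked_weight block T J W \<sigma>' R =
     (\<Sum>\<Gamma> | hypergraph \<Gamma> \<and> image_support block \<Gamma> = R \<and>
           (\<forall>\<Gamma>1\<in>block_components block \<Gamma>. image_support block \<Gamma>1 \<inter> image_set block W \<noteq> {}).
        \<integral>\<sigma>. spin_prod \<sigma> W * (\<Prod>y\<in>R \<union> image_set block W. T y \<sigma> (\<sigma>' y)) *
            (\<Prod>X\<in>\<Gamma>. exp (J X * spin_prod \<sigma> X) - 1) \<partial>spin_measure)"

definition marked_sets :: "('b \<Rightarrow> (int ^ 'd) set) \<Rightarrow> (int ^ 'd) set \<Rightarrow> 'b set set" where
  "marked_sets block W = {R. finite R \<and> (R = {} \<or> R \<inter> image_set block W \<noteq> {})}"

definition overlap :: "'b set \<Rightarrow> 'b set \<Rightarrow> real" where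
  "overlap A B = (if A \<inter> B \<noteq> {} then 1 else 0)"

text \<open>Simple graphs on \<open>{1..p}\<close>: the edge joining \<open>i < j\<close> is encoded by the pair \<open>(i, j)\<close>.\<close>

definition connected_graphs :: "nat \<Rightarrow> (nat \<times> nat) set set" where
  "connected_graphs p =
     {G. G \<subseteq> {(i, j). 1 \<le> i \<and> i < j \<and> j \<le> p} \<and>
         (\<forall>i\<in>{1..p}. \<forall>j\<in>{1..p}. (i, j) \<in> (G \<union> G\<inverse>)\<^sup>*)}"

definition cluster_coeff :: "nat \<Rightarrow> (nat \<Rightarrow> 'b set) \<Rightarrow> real" where
  "cluster_coeff p N = (\<Sum>G\<in>connected_graphs p. \<Prod>(i, j)\<in>G. - overlap (N i) (N j))"

definition polymer_tuples :: "nat \<Rightarrow> (nat \<Rightarrow> 'b set) set" where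
  "polymer_tuples p = {1..p} \<rightarrow>\<^sub>E {N. finite N \<and> N \<noteq> {}}"

definition cluster_term ::
    "('b \<Rightarrow> (int ^ 'd) set) \<Rightarrow> ('b \<Rightarrow> (int ^ 'd \<Rightarrow> real) \<Rightarrow> real \<Rightarrow> real) \<Rightarrow>
     ((int ^ 'd) set \<Rightarrow> real) \<Rightarrow> ('b \<Rightarrow> real) \<Rightarrow> 'b set \<Rightarrow> nat \<Rightarrow> (nat \<Rightarrow> 'b set) \<Rightarrow> real" where
  "cluster_term block T J \<sigma>' A p N =
     cluster_coeff p N * overlap A (\<Union>i\<in>{1..p}. N i) * (\<Prod>i=1..p. weight block T J \<sigma>' (N i))"

text \<open>The infinite-volume meaning of
  $\sum_{\Delta'}\prod_{N\in\Delta'}w_N / \sum_\Delta\prod_{N\in\Delta}w_N$,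
  where \<open>A\<close> is $R \cup W'$.\<close>

definition partition_ratio ::
    "('b \<Rightarrow> (int ^ 'd) set) \<Rightarrow> ('b \<Rightarrow> (int ^ 'd \<Rightarrow> real) \<Rightarrow> real \<Rightarrow> real) \<Rightarrow>
     ((int ^ 'd) set \<Rightarrow> real) \<Rightarrow> ('b \<Rightarrow> real) \<Rightarrow> 'b set \<Rightarrow> real" where
  "partition_ratio block T J \<sigma>' A =
     exp (- (\<Sum>\<^sub>\<infinity>p\<in>{1..}. 1 / fact p *
               (\<Sum>\<^sub>\<infinity>N\<in>polymer_tuples p. cluster_term block T J \<sigma>' A p N)))"

definition exponent_converges ::
    "('b \<Rightarrow> (int ^ 'd) set) \<Rightarrow> ('b \<Rightarrow> (int ^ 'd \<Rightarrow> real) \<Rightarrow> real \<Rightarrow> real) \<Rightarrow>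
     ((int ^ 'd) set \<Rightarrow> real) \<Rightarrow> ('b \<Rightarrow> real) \<Rightarrow> 'b set \<Rightarrow> bool" where
  "exponent_converges block T J \<sigma>' A \<longleftrightarrow>
     (\<lambda>(p, N). \<bar>1 / fact p * cluster_term block T J \<sigma>' A p N\<bar>)
       summable_on (SIGMA p:{1..}. polymer_tuples p)"

definition rg_term ::
    "('b \<Rightarrow> (int ^ 'd) set) \<Rightarrow> ('b \<Rightarrow> (int ^ 'd \<Rightarrow> real) \<Rightarrow> real \<Rightarrow> real) \<Rightarrow>
     ((int ^ 'd) set \<Rightarrow> real) \<Rightarrow> (int ^ 'd) set \<Rightarrow> ('b \<Rightarrow> real) \<Rightarrow> 'b set \<Rightarrow> real" where
  "rg_term block T J W \<sigma>' R =
     marked_weight block T J W \<sigma>' R * partition_ratio block T J \<sigma>' (R \<union> image_set block W)"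

text \<open>The partial derivative $\partial J'(Z)/\partial J(W)$ is the integral over \<open>spin_measure\<close>
  of the following function of the image configuration.\<close>

definition rg_derivative_integrand ::
    "('b \<Rightarrow> (int ^ 'd) set) \<Rightarrow> ('b \<Rightarrow> (int ^ 'd \<Rightarrow> real) \<Rightarrow> real \<Rightarrow> real) \<Rightarrow>
     ((int ^ 'd) set \<Rightarrow> real) \<Rightarrow> (int ^ 'd) set \<Rightarrow> 'b set \<Rightarrow> ('b \<Rightarrow> real) \<Rightarrow> real" where
  "rg_derivative_integrand block T J W Z \<sigma>' =
     spin_prod \<sigma>' Z * (\<Sum>\<^sub>\<infinity>R\<in>marked_sets block W. rg_term block T J W \<sigma>' R)"

definition rg_derivative_well_defined ::
    "('b \<Rightarrow> (int ^ 'd) set) \<Rightarrow> ('b \<Rightarrow> (int ^ 'd \<Rightarrow> real) \<Rightarrow> real \<Rightarrow> real) \<Rightarrow>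
     ((int ^ 'd) set \<Rightarrow> real) \<Rightarrow> (int ^ 'd) set \<Rightarrow> 'b set \<Rightarrow> bool" where
  "rg_derivative_well_defined block T J W Z \<longleftrightarrow>
     (\<forall>\<sigma>'\<in>space spin_measure.
        (\<forall>R\<in>marked_sets block W. exponent_converges block T J \<sigma>' (R \<union> image_set block W)) \<and>
        (\<lambda>R. \<bar>rg_term block T J W \<sigma>' R\<bar>) summable_on marked_sets block W) \<and>
     integrable spin_measure (rg_derivative_integrand block T J W Z)"

end

theory Submission
  imports Defs
begin

text \<open>Everything is reduced to one estimate in the style of Kotecky and Preiss. Bounding
  $|e^{J(X)\sigma_X}-1|$ by $e^{|J(X)|}-1$ and using that the kernels of distinct blocks are
  independent with mean 1, each weight is dominated uniformly in $\sigma'$ by a sum over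
  hypergraphs. Such a sum is controlled by exploring the hypergraph from a root: the links through
  a root block $y$ are removed and the blocks they touch become new roots. With
  $\kappa$ denoting the bound assumed for $\|J\|_r$ and $F=\exp(s\,\kappa\,e^{-r})$, this yields
  $\sum_{N\ni y}|w_N|M^{|N|}\le M(F-1)\le\frac14\log M$ and
  $\sum_R|\tilde w_R|M^{|R\cup W'|}\le(MF)^{|W'|}$.
  The Ursell coefficients $C(N_1,\dots,N_p)$ are bounded by the same exploration, applied to the
  connected graphs: removing a root and summing over its set of neighbours leaves, besides a
  product of edge weights, factors $1-c(N_i,N_j)\in[0,1]$ that can be dropped. The factor
  $\frac14$ makes the order $p$ of the exponent at most $4^{-p}|A|\log M$, so each ratio is
  at most $M^{|R\cup W'|}$, which the sum over $R$ absorbs.\<close>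

subsection \<open>Sums over rooted graphs\<close>

text \<open>The constant F is self-consistent. Removing a link X through a root creates at most |X'|
  - 1 new roots, each costing a factor M for the weight and a factor F for the exploration that
  continues from it. If M F \<le> e^r, these powers are absorbed by e^{r|X|} with a factor e^{-r} to
  spare, and summing over the s sites of the root block gives s \<kappa> e^{-r}, that is, ln F
  again. The constant c satisfies e^r = M (1 + c)^2, so F \<le> 1 + c is more than enough for this;
  the other demand, M (F - 1) \<le> (ln M) / 4, is the Kotecky-Preiss criterion for a(N) = |N| ln M
  with an extra factor 1/4. Both explorations turn the neighbours of a removed root into roots, so
  both inductions have to be stated for arbitrary root sets, although the cluster coefficients start
  from a single root. No limit of volumes is taken: each estimate is shown for finite families with
  a bound that does not depend on the family, and this is what absolute summability asks
  for.\<close>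

text \<open>The edges inside the root set are left out of \<open>root_pairs\<close>; this is what makes the recursion
  below close up.\<close>

definition root_pairs :: "nat set \<Rightarrow> nat set \<Rightarrow> (nat \<times> nat) set" where
  "root_pairs I V = {(a, b). a < b \<and> a \<in> I \<union> V \<and> b \<in> I \<union> V \<and> \<not> (a \<in> I \<and> b \<in> I)}"

definition star_pairs :: "nat \<Rightarrow> nat set \<Rightarrow> (nat \<times> nat) set" where
  "star_pairs i S = {(a, b). a < b \<and> (a = i \<and> b \<in> S \<or> b = i \<and> a \<in> S)}"

definition rooted_graphs :: "nat set \<Rightarrow> nat set \<Rightarrow> (nat \<times> nat) set set" where
  "rooted_graphs I V =
     {G. G \<subseteq> root_pairs I V \<and> (\<forall>v\<in>V. \<exists>i\<in>I. (i, v) \<in> (G \<union> G\<inverse>)\<^sup>*)}"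

definition rooted_sum :: "nat set \<Rightarrow> nat set \<Rightarrow> (nat \<times> nat \<Rightarrow> real) \<Rightarrow> real" where
  "rooted_sum I V z = (\<Sum>G\<in>rooted_graphs I V. \<Prod>e\<in>G. z e)"

lemma finite_root_pairs: "finite I \<Longrightarrow> finite V \<Longrightarrow> finite (root_pairs I V)"
  by (rule finite_subset[of _ "(I \<union> V) \<times> (I \<union> V)"]) (auto simp: root_pairs_def)

lemma finite_star_pairs: "finite S \<Longrightarrow> finite (star_pairs i S)"
  by (rule finite_subset[of _ "insert i S \<times> insert i S"]) (auto simp: star_pairs_def)

lemma finite_rooted_graphs: "finite I \<Longrightarrow> finite V \<Longrightarrow> finite (rooted_graphs I V)"
  by (rule finite_subset[of _ "Pow (root_pairs I V)"])
     (auto simp: rooted_graphs_def finite_root_pairs)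

text \<open>A pair containing \<open>i\<close> has its other end in \<open>V\<close>, because pairs
  of roots are excluded. The remaining pairs are sorted by whether they touch
  \<open>V - S\<close>.\<close>

lemma root_pairs_split:
  assumes "i \<in> I" "I \<inter> V = {}" "S \<subseteq> V"
  shows "root_pairs I V =
    star_pairs i V \<union> root_pairs (I - {i}) S \<union> root_pairs ((I - {i}) \<union> S) (V - S)"
  using assms by (auto simp: root_pairs_def star_pairs_def)

text \<open>A vertex that \<open>H\<close> reaches from a root in \<open>S\<close> is reached from
  \<open>i\<close> by one star edge first. The edges in \<open>E\<close> can only help, so
  \<open>E\<close> is arbitrary.\<close>

lemma rooted_graphs_combine:
  assumes i: "i \<in> I" "I \<inter> V = {}" and S: "S \<subseteq> V" and E: "E \<subseteq> root_pairs (I - {i}) S"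
    and H: "H \<in> rooted_graphs ((I - {i}) \<union> S) (V - S)"
  shows "star_pairs i S \<union> E \<union> H \<in> rooted_graphs I V"
proof -
  let ?G = "star_pairs i S \<union> E \<union> H"
  have "star_pairs i S \<subseteq> star_pairs i V" using S by (auto simp: star_pairs_def)
  hence sub: "?G \<subseteq> root_pairs I V"
    using root_pairs_split[OF i S] E H by (auto simp: rooted_graphs_def)
  have edge: "(i, s) \<in> (?G \<union> ?G\<inverse>)\<^sup>*" if "s \<in> S" for s
  proof -
    have "s \<noteq> i" using that i S by auto
    hence "(i, s) \<in> ?G \<union> ?G\<inverse>" using that by (auto simp: star_pairs_def)
    thus ?thesis by (rule r_into_rtrancl)
  qed
  have mono: "(H \<union> H\<inverse>)\<^sup>* \<subseteq> (?G \<union> ?G\<inverse>)\<^sup>*" by (rule rtrancl_mono) auto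
  have "\<exists>j\<in>I. (j, v) \<in> (?G \<union> ?G\<inverse>)\<^sup>*" if v: "v \<in> V" for v
  proof (cases "v \<in> S")
    case True
    then show ?thesis using edge i by blast
  next
    case False
    then obtain k where k: "k \<in> (I - {i}) \<union> S" "(k, v) \<in> (H \<union> H\<inverse>)\<^sup>*"
      using H v by (auto simp: rooted_graphs_def)
    then have kv: "(k, v) \<in> (?G \<union> ?G\<inverse>)\<^sup>*" using mono by blast
    show ?thesis
    proof (cases "k \<in> S")
      case True
      then show ?thesis using edge[OF True] kv i by (meson rtrancl_trans)
    qed (use k kv in auto)
  qed
  with sub show ?thesis by (auto simp: rooted_graphs_def)
qed

text \<open>Cut a path from a root at its last vertex outside \<open>V - S\<close>. That vertex is
  not \<open>i\<close>, whose neighbours in \<open>V\<close> all lie in \<open>S\<close>; hence it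
  is one of the new roots, and the rest of the path survives the restriction.\<close>

lemma rooted_graphs_restrict:
  assumes i: "i \<in> I" "I \<inter> V = {}" and G: "G \<in> rooted_graphs I V"
    and S: "S = {v\<in>V. (i, v) \<in> G \<union> G\<inverse>}"
  shows "G \<inter> root_pairs ((I - {i}) \<union> S) (V - S) \<in> rooted_graphs ((I - {i}) \<union> S) (V - S)"
    (is "?H \<in> _")
proof -
  have GP: "G \<subseteq> root_pairs I V" using G by (auto simp: rooted_graphs_def)
  \<comment> \<open>The claim is void for vertices outside \<open>V - S\<close>, so the induction
    along the path may pass through \<open>i\<close> and the old roots.\<close>
  have reach: "w \<in> V - S \<longrightarrow> (\<exists>k\<in>(I - {i}) \<union> S. (k, w) \<in> (?H \<union> ?H\<inverse>)\<^sup>*)"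
    if "(j, w) \<in> (G \<union> G\<inverse>)\<^sup>*" "j \<in> I" for j w
    using that
  proof (induction rule: rtrancl_induct)
    case base
    then show ?case using i by auto
  next
    case (step w w')
    show ?case
    proof
      assume w': "w' \<in> V - S"
      have wIV: "w \<in> I \<union> V" using step(2) GP by (auto simp: root_pairs_def)
      have "w \<noteq> i" using step(2) w' S by auto
      hence w: "w \<in> ((I - {i}) \<union> S) \<or> w \<in> V - S" using wIV by auto
      have "(w, w') \<in> ?H \<union> ?H\<inverse>"
        using step(2) w w' GP i S by (auto simp: root_pairs_def)
      then show "\<exists>k\<in>(I - {i}) \<union> S. (k, w') \<in> (?H \<union> ?H\<inverse>)\<^sup>*"
        using w step(3)[OF step(4)] by (meson r_into_rtrancl rtrancl.rtrancl_into_rtrancl)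
    qed
  qed
  show ?thesis using G reach by (fastforce simp: rooted_graphs_def)
qed

lemma star_pairs_neighbours:
  assumes "i \<in> I" "I \<inter> V = {}" "S \<subseteq> V" "E \<subseteq> root_pairs (I - {i}) S"
    "H \<subseteq> root_pairs ((I - {i}) \<union> S) (V - S)"
  shows "{v\<in>V. (i, v) \<in> (star_pairs i S \<union> E \<union> H) \<union> (star_pairs i S \<union> E \<union> H)\<inverse>} = S"
  using assms by (fastforce simp: star_pairs_def root_pairs_def)

text \<open>\<open>S\<close> is the set of neighbours of the root \<open>i\<close>. Once \<open>S\<close> has been added to the roots, the edges
  in \<open>root_pairs (I - {i}) S\<close> are unconstrained and factorize.\<close>

lemma rooted_sum_recursion:
  assumes i: "i \<in> I" "I \<inter> V = {}" and fin: "finite I" "finite V"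
  shows "rooted_sum I V z =
    (\<Sum>S\<in>Pow V. (\<Prod>e\<in>star_pairs i S. z e) * (\<Prod>e\<in>root_pairs (I - {i}) S. 1 + z e) *
       rooted_sum ((I - {i}) \<union> S) (V - S) z)"
proof -
  let ?I = "I - {i}"
  let ?N = "\<lambda>G. {v\<in>V. (i, v) \<in> G \<union> G\<inverse>}"
  let ?j = "\<lambda>G. (?N G, G \<inter> root_pairs ?I (?N G), G \<inter> root_pairs (?I \<union> ?N G) (V - ?N G))"
  let ?A = "SIGMA S:Pow V. Pow (root_pairs ?I S) \<times> rooted_graphs (?I \<union> S) (V - S)"
  have finS: "finite S" if "S \<in> Pow V" for S using that fin finite_subset by auto
  have disj: "star_pairs i S \<inter> E = {}" "(star_pairs i S \<union> E) \<inter> H = {}"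
    if "S \<in> Pow V" "E \<subseteq> root_pairs ?I S" "H \<subseteq> root_pairs (?I \<union> S) (V - S)" for S E H
    using that i by (fastforce simp: star_pairs_def root_pairs_def)+
  have "rooted_sum I V z =
    (\<Sum>(S, E, H)\<in>?A. (\<Prod>e\<in>star_pairs i S. z e) * (\<Prod>e\<in>E. z e) * (\<Prod>e\<in>H. z e))"
    unfolding rooted_sum_def
  proof (rule sum.reindex_bij_witness[where
        i = "\<lambda>(S, E, H). star_pairs i S \<union> E \<union> H" and
        j = ?j])
    fix G assume G: "G \<in> rooted_graphs I V"
    have GP: "G \<subseteq> root_pairs I V" using G by (auto simp: rooted_graphs_def)
    have NV: "?N G \<subseteq> V" by auto
    have star: "G \<inter> star_pairs i V = star_pairs i (?N G)"
      using GP i by (auto simp: star_pairs_def root_pairs_def)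
    have "G = G \<inter> star_pairs i V \<union> G \<inter> root_pairs ?I (?N G) \<union>
                G \<inter> root_pairs (?I \<union> ?N G) (V - ?N G)"
      using GP root_pairs_split[OF i NV] by blast
    then have eq: "star_pairs i (?N G) \<union> G \<inter> root_pairs ?I (?N G) \<union>
                G \<inter> root_pairs (?I \<union> ?N G) (V - ?N G) = G" unfolding star by simp
    then show "(case (?N G, G \<inter> root_pairs ?I (?N G), G \<inter> root_pairs (?I \<union> ?N G) (V - ?N G)) of
         (S, E, H) \<Rightarrow> star_pairs i S \<union> E \<union> H) = G" by simp
    show mem: "(?N G, G \<inter> root_pairs ?I (?N G), G \<inter> root_pairs (?I \<union> ?N G) (V - ?N G)) \<in> ?A"
      using rooted_graphs_restrict[OF i G refl] by auto
    have d: "star_pairs i (?N G) \<inter> (G \<inter> root_pairs ?I (?N G)) = {}"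
      "(star_pairs i (?N G) \<union> G \<inter> root_pairs ?I (?N G)) \<inter>
         (G \<inter> root_pairs (?I \<union> ?N G) (V - ?N G)) = {}"
      by (rule disj; auto)+
    have "finite G" using GP fin finite_root_pairs finite_subset by blast
    hence "(\<Prod>e\<in>G. z e) = (\<Prod>e\<in>star_pairs i (?N G). z e) *
       (\<Prod>e\<in>G \<inter> root_pairs ?I (?N G). z e) *
       (\<Prod>e\<in>G \<inter> root_pairs (?I \<union> ?N G) (V - ?N G). z e)"
      by (subst eq[symmetric], subst prod.union_disjoint, use d finS[of "?N G"] finite_star_pairs in
          \<open>simp_all add: prod.union_disjoint\<close>)
    then show "(case (?N G, G \<inter> root_pairs ?I (?N G), G \<inter> root_pairs (?I \<union> ?N G) (V - ?N G)) of
       (S, E, H) \<Rightarrow> (\<Prod>e\<in>star_pairs i S. z e) * (\<Prod>e\<in>E. z e) * (\<Prod>e\<in>H. z e)) = (\<Prod>e\<in>G. z e)"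
      by simp
  next
    fix t assume "t \<in> ?A"
    then obtain S E H where t: "t = (S, E, H)" and S: "S \<subseteq> V" and E: "E \<subseteq> root_pairs ?I S"
      and H: "H \<in> rooted_graphs (?I \<union> S) (V - S)" by auto
    have HP: "H \<subseteq> root_pairs (?I \<union> S) (V - S)" using H by (auto simp: rooted_graphs_def)
    show "(case t of (S, E, H) \<Rightarrow> star_pairs i S \<union> E \<union> H) \<in> rooted_graphs I V"
      using rooted_graphs_combine[OF i S E H] t by simp
    have N: "?N (star_pairs i S \<union> E \<union> H) = S" by (rule star_pairs_neighbours[OF i S E HP])
    have d: "star_pairs i S \<inter> root_pairs ?I S = {}"
      "star_pairs i S \<inter> root_pairs (?I \<union> S) (V - S) = {}"
      "root_pairs ?I S \<inter> root_pairs (?I \<union> S) (V - S) = {}"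
      using i S by (auto simp: star_pairs_def root_pairs_def)
    have "(star_pairs i S \<union> E \<union> H) \<inter> root_pairs ?I S = E"
      "(star_pairs i S \<union> E \<union> H) \<inter> root_pairs (?I \<union> S) (V - S) = H"
      using d E HP by blast+
    then show "?j (case t of (S, E, H) \<Rightarrow> star_pairs i S \<union> E \<union> H) = t"
      unfolding t prod.case N by simp
  qed
  also have "\<dots> = (\<Sum>S\<in>Pow V. \<Sum>(E, H)\<in>Pow (root_pairs ?I S) \<times> rooted_graphs (?I \<union> S) (V - S).
      (\<Prod>e\<in>star_pairs i S. z e) * (\<Prod>e\<in>E. z e) * (\<Prod>e\<in>H. z e))"
    by (subst sum.Sigma)
       (use fin finS in \<open>auto simp: finite_root_pairs finite_rooted_graphs\<close>)
  also have "\<dots> = (\<Sum>S\<in>Pow V. (\<Prod>e\<in>star_pairs i S. z e) *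
       (\<Sum>E\<in>Pow (root_pairs ?I S). \<Prod>e\<in>E. z e) * rooted_sum (?I \<union> S) (V - S) z)"
    by (rule sum.cong, simp, simp only: sum.cartesian_product[symmetric] rooted_sum_def)
       (simp add: sum_distrib_left sum_distrib_right mult.assoc, rule sum.swap)
  also have "\<dots> = (\<Sum>S\<in>Pow V. (\<Prod>e\<in>star_pairs i S. z e) *
      (\<Prod>e\<in>root_pairs ?I S. 1 + z e) * rooted_sum (?I \<union> S) (V - S) z)"
  proof (rule sum.cong[OF refl])
    fix S assume "S \<in> Pow V"
    then have "finite (root_pairs ?I S)" using fin finS finite_root_pairs by simp
    then have "(\<Prod>e\<in>root_pairs ?I S. z e + 1) = (\<Sum>E\<in>Pow (root_pairs ?I S). \<Prod>e\<in>E. z e)"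
      by (simp add: prod_add)
    then show "(\<Prod>e\<in>star_pairs i S. z e) * (\<Sum>E\<in>Pow (root_pairs ?I S). \<Prod>e\<in>E. z e) *
        rooted_sum (?I \<union> S) (V - S) z = (\<Prod>e\<in>star_pairs i S. z e) *
        (\<Prod>e\<in>root_pairs ?I S. 1 + z e) * rooted_sum (?I \<union> S) (V - S) z"
      by (simp add: add.commute)
  qed
  finally show ?thesis .
qed

text \<open>Iterating this inequality gives each vertex a single parent, namely the root whose
  removal added it. It is thus a tree-graph bound: the sum over graphs is controlled by rooted
  forests, without cancellations.\<close>

lemma abs_rooted_sum_le:
  assumes i: "i \<in> I" "I \<inter> V = {}" and fin: "finite I" "finite V"
    and z: "\<And>e. -1 \<le> z e" "\<And>e. z e \<le> 0"
  shows "\<bar>rooted_sum I V z\<bar> \<le>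
    (\<Sum>S\<in>Pow V. (\<Prod>e\<in>star_pairs i S. \<bar>z e\<bar>) * \<bar>rooted_sum ((I - {i}) \<union> S) (V - S) z\<bar>)"
proof -
  let ?R = "\<lambda>S. rooted_sum ((I - {i}) \<union> S) (V - S) z"
  have "\<bar>\<Prod>e\<in>root_pairs (I - {i}) S. 1 + z e\<bar> \<le> 1" for S
  proof -
    have "\<bar>1 + z e\<bar> \<le> 1" for e using z[of e] by auto
    then show ?thesis unfolding abs_prod by (intro prod_le_1) auto
  qed
  then have *: "\<bar>(\<Prod>e\<in>star_pairs i S. z e) * (\<Prod>e\<in>root_pairs (I - {i}) S. 1 + z e) * ?R S\<bar> \<le>
      (\<Prod>e\<in>star_pairs i S. \<bar>z e\<bar>) * \<bar>?R S\<bar>" for S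
    unfolding abs_mult abs_prod[symmetric]
    by (intro mult_right_mono mult_left_le) auto
  show ?thesis
    unfolding rooted_sum_recursion[OF i fin]
    by (rule order_trans[OF sum_abs sum_mono[OF *]])
qed

lemma rooted_sum_cong:
  assumes "\<And>e. e \<in> root_pairs I V \<Longrightarrow> z e = z' e"
  shows "rooted_sum I V z = rooted_sum I V z'"
  unfolding rooted_sum_def
  by (rule sum.cong[OF refl], rule prod.cong[OF refl])
     (use assms in \<open>auto simp: rooted_graphs_def\<close>)

text \<open>The Mayer factor of a repulsive interaction; with \<open>c = overlap\<close> it is the
  hard-core one. The sign makes one plus the weight lie in [0,1] whenever \<open>c\<close>
  does.\<close>

definition edge_weight :: "('n \<Rightarrow> 'n \<Rightarrow> real) \<Rightarrow> (nat \<Rightarrow> 'n) \<Rightarrow> nat \<times> nat \<Rightarrow> real" where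
  "edge_weight c N = (\<lambda>(i, j). - c (N i) (N j))"

lemma prod_star_pairs:
  assumes "i \<notin> S" "finite S" "\<And>x y. c x y = c y x" "\<And>x y. 0 \<le> c x y"
  shows "(\<Prod>e\<in>star_pairs i S. \<bar>edge_weight c N e\<bar>) = (\<Prod>s\<in>S. c (N i) (N s))"
  by (rule prod.reindex_bij_witness[where i = "\<lambda>s. (min i s, max i s)" and
        j = "\<lambda>(a, b). if a = i then b else a"])
     (use assms in \<open>auto simp: star_pairs_def edge_weight_def min_def max_def nat_less_le split: if_splits\<close>)

lemma sum_Pow_card:
  fixes g :: "nat \<Rightarrow> real"
  assumes "finite V"
  shows "(\<Sum>S\<in>Pow V. g (card S)) = (\<Sum>k\<le>card V. real (card V choose k) * g k)"
proof -
  have "(\<Sum>S\<in>Pow V. g (card S)) = (\<Sum>k\<le>card V. \<Sum>S | S \<in> Pow V \<and> card S = k. g (card S))"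
    by (rule sum.group[symmetric]) (use assms in \<open>auto intro: card_mono\<close>)
  also have "\<dots> = (\<Sum>k\<le>card V. real (card V choose k) * g k)"
    by (rule sum.cong) (use n_subsets[OF assms] in auto)
  finally show ?thesis .
qed

text \<open>There are \<open>n choose k\<close> sets of size k, and multiplying by (n - k)! leaves
  n!/k!, so the sum is n! times a truncated exponential series. In the recursion, k is the number of
  neighbours of the removed root, and this is how its factor \<open>exp (a (\<eta> i))\<close>
  arises.\<close>

lemma sum_Pow_fact_le:
  fixes x :: real
  assumes "finite V" "0 \<le> x"
  shows "(\<Sum>S\<in>Pow V. fact (card V - card S) * x ^ card S) \<le> fact (card V) * exp x"
proof -
  have "(\<Sum>S\<in>Pow V. fact (card V - card S) * x ^ card S) =
      (\<Sum>k\<le>card V. real (card V choose k) * (fact (card V - k) * x ^ k))"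
    by (rule sum_Pow_card[OF assms(1)])
  also have "\<dots> = (\<Sum>k\<le>card V. fact (card V) * (x ^ k /\<^sub>R fact k))"
    by (rule sum.cong) (simp_all add: binomial_fact field_simps)
  also have "\<dots> = fact (card V) * (\<Sum>k\<le>card V. x ^ k /\<^sub>R fact k)"
    by (simp add: sum_distrib_left)
  also have "\<dots> \<le> fact (card V) * exp x"
    unfolding exp_def using assms(2)
    by (intro mult_left_mono sum_le_suminf summable_exp_generic) auto
  finally show ?thesis .
qed

lemma sum_PiE_split:
  fixes g :: "('v \<Rightarrow> 'n) \<Rightarrow> real"
  assumes "S \<subseteq> V"
  shows "(\<Sum>N\<in>V \<rightarrow>\<^sub>E P. g N) =
    (\<Sum>N1\<in>S \<rightarrow>\<^sub>E P. \<Sum>N2\<in>(V - S) \<rightarrow>\<^sub>E P. g (override_on N2 N1 S))"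
  unfolding sum.cartesian_product
  by (rule sum.reindex_bij_witness[where i = "\<lambda>(N1, N2). override_on N2 N1 S" and
        j = "\<lambda>N. (restrict N S, restrict N (V - S))"])
     (use assms in \<open>auto simp: override_on_def PiE_iff extensional_def fun_eq_iff intro!: arg_cong[where f = g]\<close>)

text \<open>The recursion step lowers \<open>card I + card V\<close> by exactly one. The factor \<open>\<theta>\<close> gives geometric
  decay in the number of vertices, so the orders of the expansion can be treated one by one.\<close>

lemma tree_bound:
  fixes c :: "'n \<Rightarrow> 'n \<Rightarrow> real" and u a :: "'n \<Rightarrow> real" and \<theta> :: real
  assumes c: "\<And>x y. c x y = c y x" "\<And>x y. 0 \<le> c x y" "\<And>x y. c x y \<le> 1"
    and u: "\<And>x. 0 \<le> u x" and a: "\<And>x. 0 \<le> a x" and \<theta>: "0 \<le> \<theta>" and P: "finite P"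
    and KP: "\<And>x. x \<in> P \<Longrightarrow> (\<Sum>y\<in>P. c x y * u y * exp (a y)) \<le> \<theta> * a x"
  shows "finite I \<Longrightarrow> finite V \<Longrightarrow> I \<inter> V = {} \<Longrightarrow> \<eta> ` I \<subseteq> P \<Longrightarrow>
    (\<Sum>N\<in>V \<rightarrow>\<^sub>E P. \<bar>rooted_sum I V (edge_weight c (override_on \<eta> N V))\<bar> * (\<Prod>v\<in>V. u (N v)))
      \<le> fact (card V) * \<theta> ^ card V * (\<Prod>i\<in>I. exp (a (\<eta> i)))"
proof (induction "card I + card V" arbitrary: I V \<eta>)
  case 0
  then have "I = {}" "V = {}" by auto
  then show ?case by (simp add: rooted_sum_def rooted_graphs_def root_pairs_def)
next
  case (Suc n)
  note fin = Suc.prems(1,2)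
  show ?case
  proof (cases "I = {}")
    case True
    with Suc have "V \<noteq> {}" by auto
    with True have "rooted_sum I V z = 0" for z
      by (auto simp: rooted_sum_def rooted_graphs_def)
    then show ?thesis using \<theta> by (simp add: prod_nonneg)
  next
    case False
    then obtain i where i: "i \<in> I" by auto
    let ?I = "I - {i}"
    let ?z = "\<lambda>\<eta> N V. edge_weight c (override_on \<eta> N V)"
    have z: "-1 \<le> edge_weight c N e" "edge_weight c N e \<le> 0" for N e
      using c(2,3) by (auto simp: edge_weight_def split: prod.split)
    have iV: "i \<notin> V" using i Suc.prems by auto
    \<comment> \<open>For a fixed neighbour set \<open>S\<close>, the labels outside
      \<open>S\<close> are summed first, with the vertices of \<open>S\<close> already promoted to
      roots. The induction hypothesis then leaves a factor \<open>exp (a (N1 s))\<close> at each of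
      them, just what the sum in \<open>KP\<close> needs.\<close>
    have step: "(\<Sum>N\<in>V \<rightarrow>\<^sub>E P. (\<Prod>e\<in>star_pairs i S. \<bar>?z \<eta> N V e\<bar>) *
          \<bar>rooted_sum (?I \<union> S) (V - S) (?z \<eta> N V)\<bar> * (\<Prod>v\<in>V. u (N v)))
        \<le> fact (card V - card S) * (a (\<eta> i)) ^ card S * (\<theta> ^ card V * (\<Prod>i\<in>?I. exp (a (\<eta> i))))"
      if S: "S \<in> Pow V" for S
    proof -
      have finS: "finite S" using S fin finite_subset by auto
      have iS: "i \<notin> S" using S iV by auto
      have VS: "V = S \<union> (V - S)" using S by auto
      have cVS: "card (V - S) = card V - card S" "card S \<le> card V"
        using S finS fin by (auto simp: card_Diff_subset card_mono)
      have split: "(\<Prod>e\<in>star_pairs i S. \<bar>?z \<eta> (override_on N2 N1 S) V e\<bar>) *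
          \<bar>rooted_sum (?I \<union> S) (V - S) (?z \<eta> (override_on N2 N1 S) V)\<bar> *
          (\<Prod>v\<in>V. u (override_on N2 N1 S v)) =
        (\<Prod>s\<in>S. c (\<eta> i) (N1 s) * u (N1 s)) *
         (\<bar>rooted_sum (?I \<union> S) (V - S) (?z (override_on \<eta> N1 S) N2 (V - S))\<bar> * (\<Prod>v\<in>V - S. u (N2 v)))"
        for N1 N2
      proof -
        have "(\<Prod>e\<in>star_pairs i S. \<bar>?z \<eta> (override_on N2 N1 S) V e\<bar>) = (\<Prod>s\<in>S. c (\<eta> i) (N1 s))"
          unfolding prod_star_pairs[OF iS finS c(1,2)]
          by (rule prod.cong) (use S iV in \<open>auto simp: override_on_def\<close>)
        moreover have "rooted_sum (?I \<union> S) (V - S) (?z \<eta> (override_on N2 N1 S) V) =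
            rooted_sum (?I \<union> S) (V - S) (?z (override_on \<eta> N1 S) N2 (V - S))"
          by (rule arg_cong[where f = "rooted_sum _ _"])
             (use S in \<open>auto simp: edge_weight_def override_on_def fun_eq_iff\<close>)
        moreover have "(\<Prod>v\<in>V. u (override_on N2 N1 S v)) = (\<Prod>s\<in>S. u (N1 s)) * (\<Prod>v\<in>V - S. u (N2 v))"
          by (subst VS, subst prod.union_disjoint) (use finS fin in auto)
        ultimately show ?thesis by (simp add: prod.distrib mult_ac)
      qed
      have IH: "(\<Sum>N2\<in>(V - S) \<rightarrow>\<^sub>E P.
          \<bar>rooted_sum (?I \<union> S) (V - S) (?z (override_on \<eta> N1 S) N2 (V - S))\<bar> * (\<Prod>v\<in>V - S. u (N2 v)))
         \<le> fact (card (V - S)) * \<theta> ^ card (V - S) *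
            ((\<Prod>i\<in>?I. exp (a (\<eta> i))) * (\<Prod>s\<in>S. exp (a (N1 s))))"
        if N1: "N1 \<in> S \<rightarrow>\<^sub>E P" for N1
      proof -
        have disj: "?I \<inter> S = {}" using Suc.prems S by auto
        then have disj': "x \<notin> S" if "x \<in> ?I" for x using that by blast
        have "card (?I \<union> S) = card I - 1 + card S"
          using disj finS fin i by (simp add: card_Un_disjoint)
        moreover have "card I > 0" using i fin by (auto simp: card_gt_0_iff)
        ultimately have "n = card (?I \<union> S) + card (V - S)" using Suc.hyps(2) cVS by simp
        note H = Suc.hyps(1)[OF this, of "override_on \<eta> N1 S"]
        have "(\<Prod>i\<in>?I \<union> S. exp (a (override_on \<eta> N1 S i))) =
          (\<Prod>i\<in>?I. exp (a (\<eta> i))) * (\<Prod>s\<in>S. exp (a (N1 s)))"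
          by (subst prod.union_disjoint)
             (use disj disj' finS fin in \<open>auto intro!: arg_cong2[where f = "(*)"] prod.cong simp: override_on_def\<close>)
        with H show ?thesis
          using fin finS Suc.prems S N1 by (auto simp: override_on_def image_subset_iff)
      qed
      have "(\<Sum>N\<in>V \<rightarrow>\<^sub>E P. (\<Prod>e\<in>star_pairs i S. \<bar>?z \<eta> N V e\<bar>) *
          \<bar>rooted_sum (?I \<union> S) (V - S) (?z \<eta> N V)\<bar> * (\<Prod>v\<in>V. u (N v))) =
        (\<Sum>N1\<in>S \<rightarrow>\<^sub>E P. (\<Prod>s\<in>S. c (\<eta> i) (N1 s) * u (N1 s)) * (\<Sum>N2\<in>(V - S) \<rightarrow>\<^sub>E P.
         \<bar>rooted_sum (?I \<union> S) (V - S) (?z (override_on \<eta> N1 S) N2 (V - S))\<bar> * (\<Prod>v\<in>V - S. u (N2 v))))"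
        by (subst sum_PiE_split[of S V]) (use S in \<open>simp_all only: split sum_distrib_left Pow_iff\<close>)
      also have "\<dots> \<le> (\<Sum>N1\<in>S \<rightarrow>\<^sub>E P. (\<Prod>s\<in>S. c (\<eta> i) (N1 s) * u (N1 s)) *
          (fact (card (V - S)) * \<theta> ^ card (V - S) *
            ((\<Prod>i\<in>?I. exp (a (\<eta> i))) * (\<Prod>s\<in>S. exp (a (N1 s))))))"
        by (intro sum_mono mult_left_mono IH prod_nonneg mult_nonneg_nonneg c u) auto
      also have "\<dots> = fact (card (V - S)) * \<theta> ^ card (V - S) * (\<Prod>i\<in>?I. exp (a (\<eta> i))) *
          (\<Sum>N1\<in>S \<rightarrow>\<^sub>E P. \<Prod>s\<in>S. c (\<eta> i) (N1 s) * u (N1 s) * exp (a (N1 s)))"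
        by (simp add: sum_distrib_left prod.distrib mult_ac)
      \<comment> \<open>Once the rest is bounded, the neighbours carry independent labels, so the
        sum over \<open>N1\<close> is a power of a sum over one label.\<close>
      also have "(\<Sum>N1\<in>S \<rightarrow>\<^sub>E P. \<Prod>s\<in>S. c (\<eta> i) (N1 s) * u (N1 s) * exp (a (N1 s))) =
          (\<Sum>y\<in>P. c (\<eta> i) y * u y * exp (a y)) ^ card S"
        by (subst prod_sum_PiE[symmetric]) (use finS P in auto)
      also have "\<dots> \<le> (\<theta> * a (\<eta> i)) ^ card S"
        by (intro power_mono KP sum_nonneg mult_nonneg_nonneg c u) (use Suc.prems i in auto)
      \<comment> \<open>Each neighbour brings one \<open>\<theta>\<close> from \<open>KP\<close>,
        each vertex outside \<open>S\<close> one from the induction hypothesis, hence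
        \<open>\<theta>\<close> to the number of all of \<open>V\<close>.\<close>
      also have "fact (card (V - S)) * \<theta> ^ card (V - S) * (\<Prod>i\<in>?I. exp (a (\<eta> i))) * (\<theta> * a (\<eta> i)) ^ card S
        = fact (card V - card S) * a (\<eta> i) ^ card S *
            (\<theta> ^ (card V - card S) * \<theta> ^ card S * (\<Prod>i\<in>?I. exp (a (\<eta> i))))"
        by (simp add: cVS power_mult_distrib mult_ac)
      also have "\<theta> ^ (card V - card S) * \<theta> ^ card S = \<theta> ^ card V"
        using cVS(2) by (simp flip: power_add)
      finally show ?thesis
        using \<theta> by (simp add: mult_left_mono prod_nonneg)
    qed
    have "(\<Sum>N\<in>V \<rightarrow>\<^sub>E P. \<bar>rooted_sum I V (?z \<eta> N V)\<bar> * (\<Prod>v\<in>V. u (N v))) \<le>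
      (\<Sum>N\<in>V \<rightarrow>\<^sub>E P. (\<Sum>S\<in>Pow V. (\<Prod>e\<in>star_pairs i S. \<bar>?z \<eta> N V e\<bar>) *
          \<bar>rooted_sum (?I \<union> S) (V - S) (?z \<eta> N V)\<bar>) * (\<Prod>v\<in>V. u (N v)))"
      by (intro sum_mono mult_right_mono abs_rooted_sum_le prod_nonneg u z)
         (use i Suc.prems in auto)
    also have "\<dots> = (\<Sum>S\<in>Pow V. \<Sum>N\<in>V \<rightarrow>\<^sub>E P. (\<Prod>e\<in>star_pairs i S. \<bar>?z \<eta> N V e\<bar>) *
          \<bar>rooted_sum (?I \<union> S) (V - S) (?z \<eta> N V)\<bar> * (\<Prod>v\<in>V. u (N v)))"
      unfolding sum_distrib_right by (rule sum.swap)
    also have "\<dots> \<le> (\<Sum>S\<in>Pow V. fact (card V - card S) * (a (\<eta> i)) ^ card S *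
        (\<theta> ^ card V * (\<Prod>i\<in>?I. exp (a (\<eta> i)))))"
      by (rule sum_mono[OF step])
    also have "\<dots> = (\<Sum>S\<in>Pow V. fact (card V - card S) * (a (\<eta> i)) ^ card S) *
        (\<theta> ^ card V * (\<Prod>i\<in>?I. exp (a (\<eta> i))))"
      by (simp add: sum_distrib_right)
    also have "\<dots> \<le> (fact (card V) * exp (a (\<eta> i))) * (\<theta> ^ card V * (\<Prod>i\<in>?I. exp (a (\<eta> i))))"
      by (intro mult_right_mono sum_Pow_fact_le mult_nonneg_nonneg prod_nonneg a)
         (use fin \<theta> in auto)
    also have "\<dots> = fact (card V) * \<theta> ^ card V * (\<Prod>i\<in>I. exp (a (\<eta> i)))"
      using i fin by (simp add: prod.remove[of I i] mult_ac)
    finally show ?thesis .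
  qed
qed

subsection \<open>Bounds on the cluster coefficients\<close>

text \<open>Connectedness may be tested from any single vertex. That \<open>i\<close> is free
  matters later: the root is placed at a polymer that meets \<open>A\<close>.\<close>

lemma cluster_coeff_eq_rooted_sum:
  assumes "i \<in> {1..p}"
  shows "cluster_coeff p N = rooted_sum {i} ({1..p} - {i}) (edge_weight overlap N)"
proof -
  have sub: "root_pairs {i} ({1..p} - {i}) = {(i, j). 1 \<le> i \<and> i < j \<and> j \<le> p}"
    using assms by (auto simp: root_pairs_def)
  have "(\<forall>j\<in>{1..p}. \<forall>k\<in>{1..p}. (j, k) \<in> (G \<union> G\<inverse>)\<^sup>*) \<longleftrightarrow>
      (\<forall>v\<in>{1..p} - {i}. (i, v) \<in> (G \<union> G\<inverse>)\<^sup>*)" (is "?L \<longleftrightarrow> ?R") for G :: "(nat \<times> nat) set"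
  proof
    assume ?R
    then have iv: "(i, v) \<in> (G \<union> G\<inverse>)\<^sup>*" if "v \<in> {1..p}" for v using that by (cases "v = i") auto
    have "sym ((G \<union> G\<inverse>)\<^sup>*)" by (intro sym_rtrancl) (auto simp: sym_def)
    then show ?L using iv by (meson rtrancl_trans symD)
  qed (use assms in auto)
  then have "connected_graphs p = rooted_graphs {i} ({1..p} - {i})"
    unfolding connected_graphs_def rooted_graphs_def sub by auto
  then show ?thesis
    unfolding cluster_coeff_def rooted_sum_def edge_weight_def by (simp add: case_prod_unfold)
qed

lemma overlap_UN_le:
  assumes "finite I"
  shows "overlap A (\<Union>i\<in>I. N i) \<le> (\<Sum>i\<in>I. overlap A (N i))"
proof (cases "A \<inter> (\<Union>i\<in>I. N i) = {}")
  case True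
  then show ?thesis by (simp add: overlap_def sum_nonneg)
next
  case False
  then obtain i where i: "i \<in> I" "A \<inter> N i \<noteq> {}" by auto
  then have "1 = overlap A (N i)" by (simp add: overlap_def)
  also have "\<dots> \<le> (\<Sum>i\<in>I. overlap A (N i))"
    using assms i(1) by (rule member_le_sum[rotated 2]) (simp_all add: overlap_def)
  finally show ?thesis by (auto simp: overlap_def)
qed

text \<open>If the union of the polymers meets \<open>A\<close>, some polymer does; a union bound
  picks its index \<open>i\<close>, and the graph is rooted there. The tree bound sums the other
  labels, and the last label is summed by the hypothesis at \<open>A\<close> itself, hence
  \<open>insert A P\<close>. The p choices of \<open>i\<close> turn (p - 1)! into p!.\<close>

lemma cluster_sum_bound:
  fixes u a :: "'b set \<Rightarrow> real" and \<theta> :: real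
  assumes u: "\<And>x. 0 \<le> u x" and a: "\<And>x. 0 \<le> a x" and \<theta>: "0 \<le> \<theta>" and P: "finite P"
    and KP: "\<And>x. x \<in> insert A P \<Longrightarrow> (\<Sum>y\<in>P. overlap x y * u y * exp (a y)) \<le> \<theta> * a x"
    and p: "p \<ge> 1"
  shows "(\<Sum>N\<in>{1..p} \<rightarrow>\<^sub>E P. \<bar>cluster_coeff p N\<bar> * overlap A (\<Union>i\<in>{1..p}. N i) * (\<Prod>i=1..p. u (N i)))
    \<le> fact p * \<theta> ^ p * a A"
proof -
  have ov: "overlap x y = overlap y x" "0 \<le> overlap x y" "overlap x y \<le> 1" for x y :: "'b set"
    by (auto simp: overlap_def)
  have one: "(\<Sum>N\<in>{1..p} \<rightarrow>\<^sub>E P. \<bar>cluster_coeff p N\<bar> * overlap A (N i) * (\<Prod>i=1..p. u (N i)))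
      \<le> fact (p - 1) * \<theta> ^ (p - 1) * (\<theta> * a A)" if i: "i \<in> {1..p}" for i
  proof -
    let ?V = "{1..p} - {i}"
    have "(\<Sum>N\<in>{1..p} \<rightarrow>\<^sub>E P. \<bar>cluster_coeff p N\<bar> * overlap A (N i) * (\<Prod>i=1..p. u (N i))) =
      (\<Sum>N1\<in>{i} \<rightarrow>\<^sub>E P. \<Sum>N2\<in>?V \<rightarrow>\<^sub>E P. \<bar>cluster_coeff p (override_on N2 N1 {i})\<bar> *
          overlap A (N1 i) * (u (N1 i) * (\<Prod>v\<in>?V. u (N2 v))))"
    proof -
      have "(\<Prod>j=1..p. u (override_on N2 N1 {i} j)) = u (N1 i) * (\<Prod>v\<in>?V. u (N2 v))" for N1 N2
        by (subst prod.remove[of _ i]) (use i in \<open>auto simp: override_on_def\<close>)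
      then show ?thesis
        by (subst sum_PiE_split[of "{i}"]) (use i in \<open>auto simp: override_on_def\<close>)
    qed
    also have "\<dots> = (\<Sum>N1\<in>{i} \<rightarrow>\<^sub>E P. overlap A (N1 i) * u (N1 i) * (\<Sum>N2\<in>?V \<rightarrow>\<^sub>E P.
        \<bar>rooted_sum {i} ?V (edge_weight overlap (override_on N1 N2 ?V))\<bar> * (\<Prod>v\<in>?V. u (N2 v))))"
    proof -
      \<comment> \<open>Both assignments are \<open>N1\<close> at \<open>i\<close> and
        \<open>N2\<close> on \<open>?V\<close>; they may differ only at indices outside
        \<open>{1..p}\<close>, which no edge touches.\<close>
      have "rooted_sum {i} ?V (edge_weight overlap (override_on N2 N1 {i})) =
        rooted_sum {i} ?V (edge_weight overlap (override_on N1 N2 ?V))" for N1 N2 :: "nat \<Rightarrow> 'b set"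
        by (rule rooted_sum_cong) (auto simp: root_pairs_def edge_weight_def override_on_def)
      then show ?thesis
        by (simp add: cluster_coeff_eq_rooted_sum[OF i] sum_distrib_left mult_ac)
    qed
    also have "\<dots> \<le> (\<Sum>N1\<in>{i} \<rightarrow>\<^sub>E P. overlap A (N1 i) * u (N1 i) *
        (fact (card ?V) * \<theta> ^ card ?V * exp (a (N1 i))))"
    proof (intro sum_mono mult_left_mono)
      fix N1 assume "N1 \<in> {i} \<rightarrow>\<^sub>E P"
      then show "(\<Sum>N2\<in>?V \<rightarrow>\<^sub>E P. \<bar>rooted_sum {i} ?V (edge_weight overlap (override_on N1 N2 ?V))\<bar> *
          (\<Prod>v\<in>?V. u (N2 v))) \<le> fact (card ?V) * \<theta> ^ card ?V * exp (a (N1 i))"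
        using tree_bound[of overlap u a \<theta> P "{i}" ?V N1, OF ov u a \<theta> P KP] by (auto simp: PiE_iff)
    qed (use ov u in auto)
    also have "\<dots> = fact (card ?V) * \<theta> ^ card ?V *
        (\<Sum>N1\<in>{i} \<rightarrow>\<^sub>E P. \<Prod>j\<in>{i}. overlap A (N1 j) * u (N1 j) * exp (a (N1 j)))"
      by (simp add: sum_distrib_left mult_ac)
    also have "(\<Sum>N1\<in>{i} \<rightarrow>\<^sub>E P. \<Prod>j\<in>{i}. overlap A (N1 j) * u (N1 j) * exp (a (N1 j))) =
        (\<Sum>y\<in>P. overlap A y * u y * exp (a y))"
      by (subst prod_sum_PiE[symmetric]) (use P in auto)
    also have "card ?V = p - 1" using i by simp
    also have "fact (p - 1) * \<theta> ^ (p - 1) * (\<Sum>y\<in>P. overlap A y * u y * exp (a y))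
        \<le> fact (p - 1) * \<theta> ^ (p - 1) * (\<theta> * a A)"
      using \<theta> by (intro mult_left_mono KP) auto
    finally show ?thesis .
  qed
  have "(\<Sum>N\<in>{1..p} \<rightarrow>\<^sub>E P. \<bar>cluster_coeff p N\<bar> * overlap A (\<Union>i\<in>{1..p}. N i) * (\<Prod>i=1..p. u (N i)))
     \<le> (\<Sum>N\<in>{1..p} \<rightarrow>\<^sub>E P. \<bar>cluster_coeff p N\<bar> * (\<Sum>i=1..p. overlap A (N i)) * (\<Prod>i=1..p. u (N i)))"
    by (intro sum_mono mult_right_mono mult_left_mono overlap_UN_le prod_nonneg u) auto
  also have "\<dots> = (\<Sum>i=1..p. \<Sum>N\<in>{1..p} \<rightarrow>\<^sub>E P. \<bar>cluster_coeff p N\<bar> * overlap A (N i) * (\<Prod>i=1..p. u (N i)))"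
    unfolding sum_distrib_left sum_distrib_right by (rule sum.swap)
  also have "\<dots> \<le> (\<Sum>i=1..p. fact (p - 1) * \<theta> ^ (p - 1) * (\<theta> * a A))"
    by (rule sum_mono[OF one])
  also have "\<dots> = (real p * fact (p - 1)) * (\<theta> * \<theta> ^ (p - 1)) * a A"
    by (simp add: mult_ac)
  also have "\<dots> = fact p * \<theta> ^ p * a A"
    using p by (cases p) (auto simp: algebra_simps)
  finally show ?thesis .
qed

subsection \<open>Functions of finitely many spins\<close>

lemma space_spin: "\<sigma> \<in> space spin_measure \<longleftrightarrow> (\<forall>x. \<sigma> x \<in> {-1, 1})"
  by (auto simp: spin_measure_def space_PiM space_uniform_count_measure PiE_iff)

lemma space_spinI: "(\<And>x. \<sigma> x \<in> {-1, 1}) \<Longrightarrow> \<sigma> \<in> space spin_measure"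
  by (simp add: space_spin)

lemma prob_space_uniform_spin: "prob_space (uniform_count_measure {-1, 1 :: real})"
  by (rule prob_spaceI)
     (simp add: space_uniform_count_measure emeasure_uniform_count_measure)

lemma product_prob_space_spin: "product_prob_space (\<lambda>_. uniform_count_measure {-1, 1 :: real})"
  by (intro product_prob_spaceI prob_space_uniform_spin)

lemma prob_space_spin: "prob_space spin_measure"
  unfolding spin_measure_def by (rule prob_space_PiM[OF prob_space_uniform_spin])

text \<open>The notion of a cylinder function. Only genuine spin configurations are compared,
  because the kernel is constrained on those alone.\<close>

definition depends_on :: "'x set \<Rightarrow> (('x \<Rightarrow> real) \<Rightarrow> 'c) \<Rightarrow> bool" where
  "depends_on A f \<longleftrightarrow> (\<forall>\<sigma>\<in>space spin_measure. \<forall>\<tau>\<in>space spin_measure.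
     (\<forall>x\<in>A. \<sigma> x = \<tau> x) \<longrightarrow> f \<sigma> = f \<tau>)"

lemma depends_onD:
  "depends_on A f \<Longrightarrow> \<sigma> \<in> space spin_measure \<Longrightarrow> \<tau> \<in> space spin_measure \<Longrightarrow>
    (\<And>x. x \<in> A \<Longrightarrow> \<sigma> x = \<tau> x) \<Longrightarrow> f \<sigma> = f \<tau>"
  unfolding depends_on_def by blast

definition cylinder :: "'x set \<Rightarrow> ('x \<Rightarrow> real) \<Rightarrow> ('x \<Rightarrow> real) set" where
  "cylinder A e = {\<sigma>\<in>space spin_measure. \<forall>x\<in>A. \<sigma> x = e x}"

text \<open>The default value 1 off \<open>A\<close> makes the extension a spin configuration; any
  choice of spins would serve.\<close>

abbreviation spin_extend :: "'x set \<Rightarrow> ('x \<Rightarrow> real) \<Rightarrow> 'x \<Rightarrow> real" where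
  "spin_extend A e \<equiv> override_on (\<lambda>_. 1) e A"

lemma spin_extend_space: "e \<in> A \<rightarrow>\<^sub>E {-1, 1} \<Longrightarrow> spin_extend A e \<in> space spin_measure"
  unfolding PiE_iff by (rule space_spinI) (simp add: override_on_def)

lemma cylinder_subset: "cylinder A e \<subseteq> space spin_measure"
  by (auto simp: cylinder_def)

lemma coordinate_measurable: "(\<lambda>\<sigma>. \<sigma> x) \<in> borel_measurable spin_measure"
proof -
  have "(\<lambda>\<sigma>. \<sigma> x) \<in> spin_measure \<rightarrow>\<^sub>M uniform_count_measure {-1, 1 :: real}"
    unfolding spin_measure_def by (rule measurable_component_singleton) simp
  then have "(\<lambda>\<sigma>. \<sigma> x) \<in> spin_measure \<rightarrow>\<^sub>M count_space {-1, 1 :: real}"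
    unfolding measurable_cong_sets[OF refl sets_uniform_count_measure_count_space] .
  moreover have "(\<lambda>t. t) \<in> count_space {-1, 1 :: real} \<rightarrow>\<^sub>M borel" by simp
  ultimately show ?thesis by (rule measurable_compose)
qed

lemma cylinder_sets:
  assumes A: "finite A" shows "cylinder A e \<in> sets spin_measure"
proof -
  have "(\<lambda>\<sigma>. \<sigma> x) -` {e x} \<inter> space spin_measure \<in> sets spin_measure" for x
    by (rule measurable_sets[OF coordinate_measurable]) simp
  then have "{\<sigma> \<in> space spin_measure. \<sigma> x = e x} \<in> sets spin_measure" for x
    by (simp add: vimage_def Int_def conj_commute)
  then show ?thesis
    unfolding cylinder_def using A by (intro sets.sets_Collect_finite_All)
qed

lemma measure_cylinder:
  assumes "finite A" "e \<in> A \<rightarrow>\<^sub>E {-1, 1}"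
  shows "measure spin_measure (cylinder A e) = (1/2) ^ card A"
proof -
  have "emeasure spin_measure (cylinder A e) =
      (\<Prod>i\<in>A. emeasure (uniform_count_measure {-1, 1 :: real}) {e i})"
    using product_prob_space.emeasure_PiM_Collect[OF product_prob_space_spin, of A UNIV "\<lambda>i. {e i}"] assms
    by (auto simp: cylinder_def spin_measure_def sets_uniform_count_measure PiE_iff)
  also have "\<dots> = (\<Prod>i\<in>A. ennreal (1/2))"
    by (rule prod.cong) (use assms in \<open>auto simp: emeasure_uniform_count_measure PiE_iff\<close>)
  also have "\<dots> = ennreal ((1/2) ^ card A)"
    by (subst prod_ennreal) auto
  finally show ?thesis by (simp add: measure_def)
qed

text \<open>Exactly one sign pattern on \<open>A\<close> agrees with the configuration.
  Measurability, integrability and the integral of a cylinder function all follow from this finite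
  sum; in particular, the measurability of the kernel in \<open>\<sigma>\<close> is derived
  here.\<close>

lemma depends_on_expand:
  fixes f :: "('x \<Rightarrow> real) \<Rightarrow> real"
  assumes f: "depends_on A f" and A: "finite A" and \<sigma>: "\<sigma> \<in> space spin_measure"
  shows "f \<sigma> = (\<Sum>e\<in>A \<rightarrow>\<^sub>E {-1, 1}. f (spin_extend A e) * indicator (cylinder A e) \<sigma>)"
proof -
  have eA: "restrict \<sigma> A \<in> A \<rightarrow>\<^sub>E {-1, 1}" using \<sigma> by (auto simp: space_spin)
  have uniq: "e = restrict \<sigma> A" if "e \<in> A \<rightarrow>\<^sub>E {-1, 1}" "\<sigma> \<in> cylinder A e" for e
    using that by (simp add: cylinder_def fun_eq_iff PiE_iff extensional_def)
  have "(\<Sum>e\<in>A \<rightarrow>\<^sub>E {-1, 1}. f (spin_extend A e) * indicator (cylinder A e) \<sigma>) =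
    (\<Sum>e\<in>{restrict \<sigma> A}. f (spin_extend A e) * indicator (cylinder A e) \<sigma>)"
    by (rule sum.mono_neutral_right)
       (use eA uniq A in \<open>auto intro!: finite_PiE simp: indicator_def\<close>)
  also have "\<dots> = f (spin_extend A (restrict \<sigma> A))"
    using \<sigma> by (simp add: cylinder_def)
  also have "\<dots> = f \<sigma>"
    by (rule depends_onD[OF f spin_extend_space[OF eA] \<sigma>]) (simp add: override_on_def)
  finally show ?thesis by simp
qed

lemma depends_on_measurable:
  fixes f :: "('x \<Rightarrow> real) \<Rightarrow> real"
  assumes f: "depends_on A f" and A: "finite A"
  shows "f \<in> borel_measurable spin_measure"
proof -
  have "(\<lambda>\<sigma>. \<Sum>e\<in>A \<rightarrow>\<^sub>E {-1, 1}. f (spin_extend A e) * indicator (cylinder A e) \<sigma>)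
      \<in> borel_measurable spin_measure"
    by (rule borel_measurable_sum, rule borel_measurable_times, rule borel_measurable_const,
        rule borel_measurable_indicator, rule cylinder_sets[OF A])
  then show ?thesis
    by - (rule measurable_cong[THEN iffD2, rotated], assumption, erule depends_on_expand[OF f A])
qed

lemma depends_on_integral:
  fixes f :: "('x \<Rightarrow> real) \<Rightarrow> real"
  assumes f: "depends_on A f" and A: "finite A"
  shows "integrable spin_measure f"
    and "(\<integral>\<sigma>. f \<sigma> \<partial>spin_measure) = (\<Sum>e\<in>A \<rightarrow>\<^sub>E {-1, 1}. f (spin_extend A e)) / 2 ^ card A"
proof -
  interpret prob_space "spin_measure :: ('x \<Rightarrow> real) measure" by (rule prob_space_spin)
  have int: "integrable spin_measure (\<lambda>\<sigma>. f (spin_extend A e) * indicator (cylinder A e) \<sigma>)" for e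
    by (rule integrable_mult_right, rule integrable_real_indicator, rule cylinder_sets[OF A])
       (simp add: emeasure_eq_measure)
  show "integrable spin_measure f"
    by (rule Bochner_Integration.integrable_cong[THEN iffD2, OF refl], erule depends_on_expand[OF f A])
       (rule Bochner_Integration.integrable_sum[OF int])
  have "(\<integral>\<sigma>. f \<sigma> \<partial>spin_measure) =
    (\<integral>\<sigma>. (\<Sum>e\<in>A \<rightarrow>\<^sub>E {-1, 1}. f (spin_extend A e) * indicator (cylinder A e) \<sigma>) \<partial>spin_measure)"
    by (rule Bochner_Integration.integral_cong[OF refl depends_on_expand[OF f A]])
  also have "\<dots> = (\<Sum>e\<in>A \<rightarrow>\<^sub>E {-1, 1}. f (spin_extend A e) * measure spin_measure (cylinder A e))"
    by (subst Bochner_Integration.integral_sum, rule int)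
       (simp add: Int_absorb2 cylinder_subset)
  also have "\<dots> = (\<Sum>e\<in>A \<rightarrow>\<^sub>E {-1, 1}. f (spin_extend A e) / 2 ^ card A)"
    by (rule sum.cong[OF refl]) (simp add: measure_cylinder[OF A] power_divide)
  finally show "(\<integral>\<sigma>. f \<sigma> \<partial>spin_measure) = (\<Sum>e\<in>A \<rightarrow>\<^sub>E {-1, 1}. f (spin_extend A e)) / 2 ^ card A"
    by (simp add: sum_divide_distrib)
qed

lemma depends_on_mult:
  fixes f g :: "('x \<Rightarrow> real) \<Rightarrow> real"
  shows "depends_on A f \<Longrightarrow> depends_on B g \<Longrightarrow> depends_on (A \<union> B) (\<lambda>\<sigma>. f \<sigma> * g \<sigma>)"
  unfolding depends_on_def by (metis UnI1 UnI2)

lemma depends_on_prod: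
  fixes f :: "'i \<Rightarrow> ('x \<Rightarrow> real) \<Rightarrow> real"
  assumes "\<And>i. i \<in> I \<Longrightarrow> depends_on (A i) (f i)"
  shows "depends_on (\<Union>i\<in>I. A i) (\<lambda>\<sigma>. \<Prod>i\<in>I. f i \<sigma>)"
  unfolding depends_on_def
  by (intro ballI impI prod.cong refl, rule depends_onD[OF assms]) auto

text \<open>Independence by counting: a sign pattern on \<open>A \<union> B\<close> is a pair of
  patterns, and the powers of 2 multiply.\<close>

lemma integral_spin_mult:
  fixes f g :: "('x \<Rightarrow> real) \<Rightarrow> real"
  assumes f: "depends_on A f" and g: "depends_on B g" and fin: "finite A" "finite B"
    and disj: "A \<inter> B = {}"
  shows "(\<integral>\<sigma>. f \<sigma> * g \<sigma> \<partial>spin_measure) = (\<integral>\<sigma>. f \<sigma> \<partial>spin_measure) * (\<integral>\<sigma>. g \<sigma> \<partial>spin_measure)"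
proof -
  have eq: "f (spin_extend (A \<union> B) (override_on e2 e1 A)) = f (spin_extend A e1)"
    "g (spin_extend (A \<union> B) (override_on e2 e1 A)) = g (spin_extend B e2)"
    if "e1 \<in> A \<rightarrow>\<^sub>E {-1, 1}" "e2 \<in> B \<rightarrow>\<^sub>E {-1, 1}" for e1 e2
  proof -
    have sp: "spin_extend (A \<union> B) (override_on e2 e1 A) \<in> space spin_measure"
      using that unfolding PiE_iff by (intro space_spinI) (simp add: override_on_def)
    show "f (spin_extend (A \<union> B) (override_on e2 e1 A)) = f (spin_extend A e1)"
      by (rule depends_onD[OF f sp spin_extend_space[OF that(1)]]) (auto simp: override_on_def)
    show "g (spin_extend (A \<union> B) (override_on e2 e1 A)) = g (spin_extend B e2)"
      by (rule depends_onD[OF g sp spin_extend_space[OF that(2)]])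
         (use disj in \<open>auto simp: override_on_def\<close>)
  qed
  have "(\<Sum>e\<in>(A \<union> B) \<rightarrow>\<^sub>E {-1, 1}. f (spin_extend (A \<union> B) e) * g (spin_extend (A \<union> B) e)) =
    (\<Sum>e1\<in>A \<rightarrow>\<^sub>E {-1, 1}. \<Sum>e2\<in>B \<rightarrow>\<^sub>E {-1, 1}. f (spin_extend A e1) * g (spin_extend B e2))"
    by (subst sum_PiE_split[of A])
       (use eq disj in \<open>auto intro!: sum.cong simp: Un_Diff Diff_triv Int_commute\<close>)
  then show ?thesis
    using depends_on_integral(2)[OF depends_on_mult[OF f g]] fin disj
      depends_on_integral(2)[OF f] depends_on_integral(2)[OF g]
    by (simp add: card_Un_disjoint power_add flip: sum_product)
qed

text \<open>The flip permutes the sign patterns on \<open>A\<close>. Off \<open>A\<close> the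
  flipped extension is -1 instead of the default 1, which \<open>f\<close> does not see.\<close>

lemma integral_spin_flip:
  fixes f :: "('x \<Rightarrow> real) \<Rightarrow> real"
  assumes f: "depends_on A f" and A: "finite A"
  shows "(\<integral>\<sigma>. f (\<lambda>x. - \<sigma> x) \<partial>spin_measure) = (\<integral>\<sigma>. f \<sigma> \<partial>spin_measure)"
proof -
  have sp: "(\<lambda>x. - \<sigma> x) \<in> space spin_measure" if "\<sigma> \<in> space spin_measure" for \<sigma> :: "'x \<Rightarrow> real"
    using that by (auto simp: space_spin)
  have f': "depends_on A (\<lambda>\<sigma>. f (\<lambda>x. - \<sigma> x))"
    unfolding depends_on_def
    by (intro ballI impI depends_onD[OF f] sp) auto
  have "(\<Sum>e\<in>A \<rightarrow>\<^sub>E {-1, 1}. f (\<lambda>x. - spin_extend A e x)) = (\<Sum>e\<in>A \<rightarrow>\<^sub>E {-1, 1}. f (spin_extend A e))"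
  proof (rule sum.reindex_bij_witness[where i = "\<lambda>e. \<lambda>x\<in>A. - e x" and j = "\<lambda>e. \<lambda>x\<in>A. - e x"])
    fix e :: "'x \<Rightarrow> real" assume e: "e \<in> A \<rightarrow>\<^sub>E {-1, 1}"
    show e': "(\<lambda>x\<in>A. - e x) \<in> A \<rightarrow>\<^sub>E {-1, 1}" using e unfolding PiE_iff by auto
    show "f (spin_extend A (\<lambda>x\<in>A. - e x)) = f (\<lambda>x. - spin_extend A e x)"
      by (rule depends_onD[OF f spin_extend_space[OF e'] sp[OF spin_extend_space[OF e]]])
         (auto simp: override_on_def)
  qed (auto simp: fun_eq_iff PiE_iff extensional_def)
  then show ?thesis
    unfolding depends_on_integral(2)[OF f A] depends_on_integral(2)[OF f' A] by simp
qed

lemma integral_spin_coordinate: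
  "(\<integral>\<sigma>. g (\<sigma> y) \<partial>spin_measure) = (g 1 + g (-1 :: real)) / (2 :: real)"
proof -
  have "depends_on {y} (\<lambda>\<sigma>. g (\<sigma> y))" by (simp add: depends_on_def)
  then have "(\<integral>\<sigma>. g (\<sigma> y) \<partial>spin_measure) =
      (\<Sum>e\<in>{y} \<rightarrow>\<^sub>E {-1, 1}. \<Prod>x\<in>{y}. g (e x)) / 2 ^ card {y}"
    using depends_on_integral(2)[of "{y}" "\<lambda>\<sigma>. g (\<sigma> y)"] by (simp add: override_on_def)
  also have "(\<Sum>e\<in>{y} \<rightarrow>\<^sub>E {-1, 1}. \<Prod>x\<in>{y}. g (e x)) = g 1 + g (-1)"
    by (subst prod_sum_PiE[symmetric]) (auto simp: add.commute)
  finally show ?thesis by simp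
qed

subsection \<open>Block kernels\<close>

lemma block_partitionD:
  assumes "block_partition block s"
  shows "finite (block y)" "block y \<noteq> {}" "card (block y) = s"
    "y \<noteq> z \<Longrightarrow> block y \<inter> block z = {}" "\<exists>y. x \<in> block y"
proof -
  have P: "partition_on UNIV (range block)" "inj block" using assms by (auto simp: block_partition_def)
  show "finite (block y)" "card (block y) = s" using assms by (auto simp: block_partition_def)
  show "block y \<noteq> {}" using P(1) by (metis partition_onD3 rangeI)
  show "block y \<inter> block z = {}" if "y \<noteq> z"
    using that P by (metis partition_onD2 disjointD rangeI injD)
  show "\<exists>y. x \<in> block y" using partition_onD1[OF P(1)] by auto
qed

lemma spin_prod_pm1:
  assumes "\<sigma> \<in> space spin_measure"
  shows "spin_prod \<sigma> X \<in> {-1, 1}"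
proof (cases "finite X")
  case True
  then show ?thesis unfolding spin_prod_def
  proof (induction X rule: finite_induct)
    case (insert x X)
    then show ?case using assms[unfolded space_spin, rule_format, of x] by auto
  qed simp
qed (simp add: spin_prod_def)

lemma depends_on_spin_prod: "depends_on X (\<lambda>\<sigma>. spin_prod \<sigma> X)"
  unfolding depends_on_def spin_prod_def by (intro ballI impI prod.cong) auto

lemma depends_on_comp: "depends_on A f \<Longrightarrow> depends_on A (\<lambda>\<sigma>. g (f \<sigma>))"
  unfolding depends_on_def by metis

lemma kernel_nonneg:
  "rg_kernel block T \<Longrightarrow> \<sigma> \<in> space spin_measure \<Longrightarrow> t \<in> {-1, 1} \<Longrightarrow> 0 \<le> T y \<sigma> t"
  unfolding rg_kernel_def by blast

lemma depends_on_kernel: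
  assumes "rg_kernel block T" "t \<in> {-1, 1}"
  shows "depends_on (block y) (\<lambda>\<sigma>. T y \<sigma> t)"
  unfolding depends_on_def using assms unfolding rg_kernel_def by blast

text \<open>Normalization in the image spin gives
  \<open>T y \<sigma> 1 + T y \<sigma> (-1) = 2\<close> pointwise. By the joint flip symmetry the
  two terms have equal integrals, so each integral is 1.\<close>

lemma integral_kernel:
  assumes bp: "block_partition block s" and T: "rg_kernel block T" and t: "t \<in> {-1, 1}"
  shows "(\<integral>\<sigma>. T y \<sigma> t \<partial>spin_measure) = 1"
proof -

  have fin: "finite (block y)" using block_partitionD[OF bp] by simp
  have dep: "depends_on (block y) (\<lambda>\<sigma>. T y \<sigma> t)" if "t \<in> {-1, 1}" for t
    using depends_on_kernel[OF T that] .
  have flip: "T y \<sigma> t = T y (\<lambda>x. - \<sigma> x) (- t)" if "\<sigma> \<in> space spin_measure" "t \<in> {-1, 1}" for \<sigma> t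
    using T that unfolding rg_kernel_def by blast
  have norm: "(T y \<sigma> 1 + T y \<sigma> (-1)) / 2 = 1" if "\<sigma> \<in> space spin_measure" for \<sigma>
    using T that integral_spin_coordinate[of "T y \<sigma>" y] unfolding rg_kernel_def by metis
  have sym: "(\<integral>\<sigma>. T y \<sigma> 1 \<partial>spin_measure) = (\<integral>\<sigma>. T y \<sigma> (-1) \<partial>spin_measure)"
  proof -
    have "(\<integral>\<sigma>. T y \<sigma> 1 \<partial>spin_measure) = (\<integral>\<sigma>. T y (\<lambda>x. - \<sigma> x) (-1) \<partial>spin_measure)"
      by (rule Bochner_Integration.integral_cong[OF refl]) (rule flip[where t = 1, simplified])
    also have "\<dots> = (\<integral>\<sigma>. T y \<sigma> (-1) \<partial>spin_measure)"
      by (rule integral_spin_flip[OF dep fin]) simp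
    finally show ?thesis .
  qed
  have "(\<integral>\<sigma>. T y \<sigma> 1 \<partial>spin_measure) + (\<integral>\<sigma>. T y \<sigma> (-1) \<partial>spin_measure) =
      (\<integral>\<sigma>. T y \<sigma> 1 + T y \<sigma> (-1) \<partial>spin_measure)"
    by (rule Bochner_Integration.integral_add[symmetric])
       (rule depends_on_integral(1)[OF dep fin]; simp)+
  also have "\<dots> = (\<integral>\<sigma>. 2 \<partial>(spin_measure :: (int ^ 'b \<Rightarrow> real) measure))"
    by (rule Bochner_Integration.integral_cong[OF refl]) (use norm in force)
  also have "\<dots> = 2"
    using prob_space.prob_space[OF prob_space_spin] by simp
  finally show ?thesis using sym t by auto
qed

lemma kernel_prod_depends:
  assumes "rg_kernel block T" "\<sigma>' \<in> space spin_measure"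
  shows "depends_on (\<Union>y\<in>N. block y) (\<lambda>\<sigma>. \<Prod>y\<in>N. T y \<sigma> (\<sigma>' y))"
  by (rule depends_on_prod depends_on_kernel[OF assms(1)])+ (use assms(2) in \<open>simp add: space_spin\<close>)

lemma integral_kernel_prod:
  assumes bp: "block_partition block s" and T: "rg_kernel block T" and s': "\<sigma>' \<in> space spin_measure"
    and N: "finite N"
  shows "(\<integral>\<sigma>. (\<Prod>y\<in>N. T y \<sigma> (\<sigma>' y)) \<partial>spin_measure) = 1"
  using N
proof (induction N rule: finite_induct)
  case empty
  then show ?case using prob_space.prob_space[OF prob_space_spin] by simp
next
  case (insert y N)
  have t: "\<sigma>' y \<in> {-1, 1}" using s' by (simp add: space_spin)
  have "(\<integral>\<sigma>. (\<Prod>y\<in>insert y N. T y \<sigma> (\<sigma>' y)) \<partial>spin_measure) =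
      (\<integral>\<sigma>. T y \<sigma> (\<sigma>' y) * (\<Prod>y\<in>N. T y \<sigma> (\<sigma>' y)) \<partial>spin_measure)"
    using insert by simp
  also have "\<dots> = (\<integral>\<sigma>. T y \<sigma> (\<sigma>' y) \<partial>spin_measure) * (\<integral>\<sigma>. (\<Prod>y\<in>N. T y \<sigma> (\<sigma>' y)) \<partial>spin_measure)"
  proof (rule integral_spin_mult[OF depends_on_kernel[OF T t] kernel_prod_depends[OF T s']])
    show "block y \<inter> (\<Union>y\<in>N. block y) = {}"
      using insert(2) block_partitionD(4)[OF bp, of y] by fastforce
  qed (use insert block_partitionD[OF bp] in auto)
  finally show ?case using insert.IH integral_kernel[OF bp T t] by simp
qed

text \<open>For fixed \<open>\<sigma>'\<close> the kernel product is a probability density in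
  \<open>\<sigma>\<close>, nonnegative with mean 1, so the integral is an average of
  \<open>g\<close>. This removes \<open>\<sigma>'\<close> from all later estimates.\<close>

lemma abs_integral_kernel_prod_le:
  assumes bp: "block_partition block s" and T: "rg_kernel block T" and s': "\<sigma>' \<in> space spin_measure"
    and N: "finite N" and g: "depends_on A g" "finite A"
    and v: "\<And>\<sigma>. \<sigma> \<in> space spin_measure \<Longrightarrow> \<bar>g \<sigma>\<bar> \<le> v"
  shows "\<bar>\<integral>\<sigma>. (\<Prod>y\<in>N. T y \<sigma> (\<sigma>' y)) * g \<sigma> \<partial>spin_measure\<bar> \<le> v"
proof -
  let ?P = "\<lambda>\<sigma>. \<Prod>y\<in>N. T y \<sigma> (\<sigma>' y)"
  have fin: "finite (\<Union>y\<in>N. block y)" using N block_partitionD[OF bp] by auto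
  note dP = kernel_prod_depends[OF T s', of N]
  have nn: "0 \<le> ?P \<sigma>" if "\<sigma> \<in> space spin_measure" for \<sigma>
    using that s' by (intro prod_nonneg ballI kernel_nonneg[OF T]) (auto simp: space_spin)
  have "\<bar>\<integral>\<sigma>. ?P \<sigma> * g \<sigma> \<partial>spin_measure\<bar> \<le> (\<integral>\<sigma>. \<bar>?P \<sigma> * g \<sigma>\<bar> \<partial>spin_measure)"
    using integral_norm_bound[of spin_measure "\<lambda>\<sigma>. ?P \<sigma> * g \<sigma>"] by simp
  also have "\<dots> \<le> (\<integral>\<sigma>. v * ?P \<sigma> \<partial>spin_measure)"
  proof (rule integral_mono)
    show "integrable spin_measure (\<lambda>\<sigma>. \<bar>?P \<sigma> * g \<sigma>\<bar>)"
      using depends_on_integral(1)[OF depends_on_mult[OF dP g(1)]] fin g(2) by simp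
    show "integrable spin_measure (\<lambda>\<sigma>. v * ?P \<sigma>)"
      using depends_on_integral(1)[OF dP fin] by simp
    show "\<bar>?P \<sigma> * g \<sigma>\<bar> \<le> v * ?P \<sigma>" if "\<sigma> \<in> space spin_measure" for \<sigma>
      using mult_left_mono[OF v[OF that] nn[OF that]] nn[OF that] by (simp add: abs_mult mult.commute)
  qed
  also have "\<dots> = v" using integral_kernel_prod[OF bp T s' N] by simp
  finally show ?thesis .
qed

subsection \<open>Sums over rooted hypergraphs\<close>

text \<open>Only the images \<open>D X\<close> of the links matter. A family is rooted in \<open>I\<close> if each of its connected
  components meets \<open>I\<close>; quantifying over all closed parts, which are the unions of components, avoids
  decomposing the family.\<close>

definition closed_part :: "('l \<Rightarrow> 'b set) \<Rightarrow> 'l set \<Rightarrow> 'l set \<Rightarrow> bool" where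
  "closed_part D \<Gamma>1 \<Gamma> \<longleftrightarrow> \<Gamma>1 \<subseteq> \<Gamma> \<and> (\<forall>X\<in>\<Gamma>1. \<forall>Y\<in>\<Gamma> - \<Gamma>1. D X \<inter> D Y = {})"

definition rooted_family :: "('l \<Rightarrow> 'b set) \<Rightarrow> 'b set \<Rightarrow> 'l set \<Rightarrow> bool" where
  "rooted_family D I \<Gamma> \<longleftrightarrow>
     (\<forall>\<Gamma>1. \<Gamma>1 \<noteq> {} \<longrightarrow> closed_part D \<Gamma>1 \<Gamma> \<longrightarrow> (\<Union>X\<in>\<Gamma>1. D X) \<inter> I \<noteq> {})"

text \<open>A closed part of the remainder that avoids the new roots avoids \<open>y\<close> as
  well, since every link through \<open>y\<close> is in \<open>A\<close>. It is then disjoint from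
  all of \<open>I\<close> and from the links in \<open>A\<close>, so it would be a closed part of
  \<open>\<Gamma>\<close> without a root.\<close>

lemma rooted_family_peel:
  assumes "rooted_family D I \<Gamma>" "A = {X\<in>\<Gamma>. y \<in> D X}"
  shows "rooted_family D ((I - {y}) \<union> ((\<Union>X\<in>A. D X) - I)) (\<Gamma> - A)"
  unfolding rooted_family_def
proof (intro allI impI notI)
  fix \<Gamma>1 assume \<Gamma>1: "\<Gamma>1 \<noteq> {}" "closed_part D \<Gamma>1 (\<Gamma> - A)"
    and e: "(\<Union>X\<in>\<Gamma>1. D X) \<inter> ((I - {y}) \<union> ((\<Union>X\<in>A. D X) - I)) = {}"
  have y: "y \<notin> D X" if "X \<in> \<Gamma>1" for X
    using that \<Gamma>1(2) assms(2) by (auto simp: closed_part_def)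
  have I: "D X \<inter> I = {}" if "X \<in> \<Gamma>1" for X using y[OF that] e that by auto
  have "\<forall>X\<in>\<Gamma>1. \<forall>Y\<in>A. D X \<inter> D Y = {}"
    using I e by blast
  then have "closed_part D \<Gamma>1 \<Gamma>"
    using \<Gamma>1(2) unfolding closed_part_def by (metis Diff_iff Diff_subset subset_trans)
  then show False using assms(1) \<Gamma>1(1) I by (auto simp: rooted_family_def)
qed

text \<open>Convexity of exp at u = (1/t) (t u) + (1 - 1/t) 0. With u the strength of a link and t
  its powers of \<open>M * F\<close>, this turns a product over links into the exponential of the
  linear sum that the norm controls.\<close>

lemma one_plus_mult_exp_le:
  fixes u t :: real
  assumes "1 \<le> t"
  shows "1 + t * (exp u - 1) \<le> exp (t * u)"
proof -
  have "exp ((1 - 1 / t) *\<^sub>R 0 + (1 / t) *\<^sub>R (t * u)) \<le> (1 - 1 / t) * exp 0 + (1 / t) * exp (t * u)"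
    by (rule convex_onD[OF exp_convex]) (use assms in auto)
  then have "exp u \<le> (1 - 1 / t) + exp (t * u) / t" using assms by simp
  then have "t * exp u \<le> t * ((1 - 1 / t) + exp (t * u) / t)"
    using assms by (intro mult_left_mono) auto
  also have "\<dots> = t - 1 + exp (t * u)" using assms by (simp add: field_simps)
  finally show ?thesis by (simp add: algebra_simps)
qed

text \<open>Remove a root \<open>y\<close> together with the set \<open>A\<close> of links through
  it. Each block newly touched by \<open>A\<close> costs \<open>M\<close> for the weight and
  \<open>F\<close> as a root of the remainder, and the other old roots give
  \<open>F ^ (card I - 1)\<close>. Summed over \<open>A\<close>, the links through \<open>y\<close>
  contribute at most \<open>exp (ln F)\<close>, the missing factor \<open>F\<close>.\<close>

lemma rooted_family_sum_le:
  fixes D :: "'l \<Rightarrow> 'b set" and j :: "'l \<Rightarrow> real" and M F :: real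
  assumes M: "1 \<le> M" and F: "1 \<le> F" and j: "\<And>X. 0 \<le> j X"
  shows "finite \<X> \<Longrightarrow> (\<And>X. X \<in> \<X> \<Longrightarrow> finite (D X)) \<Longrightarrow>
     (\<And>y. (\<Sum>X | X \<in> \<X> \<and> y \<in> D X. j X * (M * F) ^ (card (D X) - 1)) \<le> ln F) \<Longrightarrow> finite I \<Longrightarrow>
    (\<Sum>\<Gamma> | \<Gamma> \<subseteq> \<X> \<and> rooted_family D I \<Gamma>.
       (\<Prod>X\<in>\<Gamma>. exp (j X) - 1) * M ^ card ((\<Union>X\<in>\<Gamma>. D X) - I)) \<le> F ^ card I"
proof (induction "card (I \<union> (\<Union>X\<in>\<X>. D X))" arbitrary: I \<X> rule: less_induct)
  case less
  note fin = less.prems(1,4) and finD = less.prems(2)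
  let ?w = "\<lambda>\<Gamma>. \<Prod>X\<in>\<Gamma>. exp (j X) - 1"
  have w: "0 \<le> ?w \<Gamma>" for \<Gamma> by (intro prod_nonneg) (use j in auto)
  show ?case
  proof (cases "I = {}")
    case True
    have "{\<Gamma>. \<Gamma> \<subseteq> \<X> \<and> rooted_family D I \<Gamma>} = {{}}"
      using True by (auto simp: rooted_family_def closed_part_def)
    then show ?thesis using True by simp
  next
    case False
    then obtain y where y: "y \<in> I" by auto
    define Y where "Y = {X\<in>\<X>. y \<in> D X}"
    define S where "S = (\<lambda>A. (\<Union>X\<in>A. D X) - I)"
    define IA where "IA = (\<lambda>A. (I - {y}) \<union> S A)"
    let ?P = "SIGMA A:Pow Y. {B. B \<subseteq> \<X> - Y \<and> rooted_family D (IA A) B}"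
    have finY: "finite Y" "Y \<subseteq> \<X>" using fin by (auto simp: Y_def)
    have finA: "finite A" "finite (S A)" if "A \<subseteq> Y" for A
    proof -
      show "finite A" using that finY finite_subset by auto
      moreover have "finite (D X)" if "X \<in> A" for X using that \<open>A \<subseteq> Y\<close> finY(2) finD by auto
      ultimately have "finite (\<Union>X\<in>A. D X)" by simp
      then show "finite (S A)" by (simp add: S_def)
    qed
    have finB: "finite {B. B \<subseteq> \<X> - Y \<and> rooted_family D (IA A) B}" for A
      by (rule finite_subset[of _ "Pow \<X>"]) (use fin in auto)
    have cIA: "card (IA A) = card I - 1 + card (S A)" "finite (IA A)" if "A \<subseteq> Y" for A
    proof -
      have "(I - {y}) \<inter> S A = {}" by (auto simp: S_def)
      then show "card (IA A) = card I - 1 + card (S A)" "finite (IA A)"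
        using finA[OF that] fin y by (simp_all add: IA_def card_Un_disjoint)
    qed
    have step: "(\<Sum>B | B \<subseteq> \<X> - Y \<and> rooted_family D (IA A) B. ?w B * M ^ card ((\<Union>X\<in>B. D X) - IA A))
        \<le> F ^ card (IA A)" if A: "A \<subseteq> Y" for A
    proof (rule less.hyps)
      have fU: "finite (I \<union> (\<Union>X\<in>\<X>. D X))" using fin finD by auto
      \<comment> \<open>The remaining links avoid \<open>y\<close>, so \<open>y\<close> leaves the
        set of blocks in play and the induction measure drops.\<close>
      have "IA A \<union> (\<Union>X\<in>\<X> - Y. D X) \<subseteq> (I \<union> (\<Union>X\<in>\<X>. D X)) - {y}"
        using A finY y by (fastforce simp: IA_def S_def Y_def)
      then have "IA A \<union> (\<Union>X\<in>\<X> - Y. D X) \<subset> I \<union> (\<Union>X\<in>\<X>. D X)" using y by blast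
      then show "card (IA A \<union> (\<Union>X\<in>\<X> - Y. D X)) < card (I \<union> (\<Union>X\<in>\<X>. D X))"
        by (rule psubset_card_mono[OF fU])
      show "(\<Sum>X | X \<in> \<X> - Y \<and> z \<in> D X. j X * (M * F) ^ (card (D X) - 1)) \<le> ln F" for z
        by (rule order_trans[OF sum_mono2 less.prems(3)[of z]]) (use fin j M F in auto)
    qed (use fin finD cIA[OF A] in auto)
    have "(\<Sum>\<Gamma> | \<Gamma> \<subseteq> \<X> \<and> rooted_family D I \<Gamma>. ?w \<Gamma> * M ^ card ((\<Union>X\<in>\<Gamma>. D X) - I)) \<le>
      (\<Sum>(A, B)\<in>?P. ?w A * M ^ card (S A) * (?w B * M ^ card ((\<Union>X\<in>B. D X) - IA A)))"
    proof (rule sum_le_included[where i = "\<lambda>(A, B). A \<union> B"])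
      show "finite {\<Gamma>. \<Gamma> \<subseteq> \<X> \<and> rooted_family D I \<Gamma>}"
        by (rule finite_subset[of _ "Pow \<X>"]) (use fin in auto)
      show "finite ?P" using finY finB by (intro finite_SigmaI) auto
      show "\<forall>x\<in>?P. 0 \<le> (case x of (A, B) \<Rightarrow>
          ?w A * M ^ card (S A) * (?w B * M ^ card ((\<Union>X\<in>B. D X) - IA A)))"
        using w M by (auto intro!: mult_nonneg_nonneg)
      show "\<forall>\<Gamma>\<in>{\<Gamma>. \<Gamma> \<subseteq> \<X> \<and> rooted_family D I \<Gamma>}. \<exists>x\<in>?P. (case x of (A, B) \<Rightarrow> A \<union> B) = \<Gamma> \<and>
         ?w \<Gamma> * M ^ card ((\<Union>X\<in>\<Gamma>. D X) - I) \<le> (case x of (A, B) \<Rightarrow>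
          ?w A * M ^ card (S A) * (?w B * M ^ card ((\<Union>X\<in>B. D X) - IA A)))"
      proof
        fix \<Gamma> assume \<Gamma>: "\<Gamma> \<in> {\<Gamma>. \<Gamma> \<subseteq> \<X> \<and> rooted_family D I \<Gamma>}"
        define A where "A = {X\<in>\<Gamma>. y \<in> D X}"
        have AY: "A \<subseteq> Y" "\<Gamma> - A \<subseteq> \<X> - Y" using \<Gamma> by (auto simp: A_def Y_def)
        have fin\<Gamma>: "finite \<Gamma>" using \<Gamma> fin finite_subset by auto
        have AB: "A \<union> (\<Gamma> - A) = \<Gamma>" by (auto simp: A_def)
        have mem: "(A, \<Gamma> - A) \<in> ?P"
          using AY rooted_family_peel[of D I \<Gamma> A y] \<Gamma> A_def by (auto simp: IA_def S_def)
        have w\<Gamma>: "?w \<Gamma> = ?w A * ?w (\<Gamma> - A)"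
          by (subst AB[symmetric], subst prod.union_disjoint) (use fin\<Gamma> finite_subset[of A \<Gamma>] in \<open>auto simp: A_def\<close>)
        have "(\<Union>X\<in>\<Gamma>. D X) - I \<subseteq> S A \<union> ((\<Union>X\<in>\<Gamma> - A. D X) - IA A)"
          by (auto simp: S_def IA_def)
        moreover have "finite (S A \<union> ((\<Union>X\<in>\<Gamma> - A. D X) - IA A))"
          using finA[OF AY(1)] fin\<Gamma> \<Gamma> finD by auto
        ultimately have "card ((\<Union>X\<in>\<Gamma>. D X) - I) \<le> card (S A) + card ((\<Union>X\<in>\<Gamma> - A. D X) - IA A)"
          by (meson card_mono card_Un_le order_trans)
        then have "?w \<Gamma> * M ^ card ((\<Union>X\<in>\<Gamma>. D X) - I) \<le>
            ?w \<Gamma> * M ^ (card (S A) + card ((\<Union>X\<in>\<Gamma> - A. D X) - IA A))"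
          using M w by (intro mult_left_mono power_increasing) auto
        also have "\<dots> = ?w A * M ^ card (S A) * (?w (\<Gamma> - A) * M ^ card ((\<Union>X\<in>\<Gamma> - A. D X) - IA A))"
          by (simp add: w\<Gamma> power_add)
        finally show "\<exists>x\<in>?P. (case x of (A, B) \<Rightarrow> A \<union> B) = \<Gamma> \<and>
         ?w \<Gamma> * M ^ card ((\<Union>X\<in>\<Gamma>. D X) - I) \<le> (case x of (A, B) \<Rightarrow>
          ?w A * M ^ card (S A) * (?w B * M ^ card ((\<Union>X\<in>B. D X) - IA A)))"
          using mem AB by (intro bexI[of _ "(A, \<Gamma> - A)"]) auto
      qed
    qed
    also have "\<dots> = (\<Sum>A\<in>Pow Y. ?w A * M ^ card (S A) *
        (\<Sum>B | B \<subseteq> \<X> - Y \<and> rooted_family D (IA A) B. ?w B * M ^ card ((\<Union>X\<in>B. D X) - IA A)))"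
      by (subst sum.Sigma[symmetric]) (use finY finB in \<open>auto simp: sum_distrib_left\<close>)
    also have "\<dots> \<le> (\<Sum>A\<in>Pow Y. ?w A * M ^ card (S A) * F ^ card (IA A))"
      by (intro sum_mono mult_left_mono step mult_nonneg_nonneg w) (use M in auto)
    also have "\<dots> \<le> (\<Sum>A\<in>Pow Y. F ^ (card I - 1) * (\<Prod>X\<in>A. (exp (j X) - 1) * (M * F) ^ (card (D X) - 1)))"
    proof (rule sum_mono)
      fix A assume "A \<in> Pow Y"
      then have A: "A \<subseteq> Y" by simp
      \<comment> \<open>A link through \<open>y\<close> creates at most
        \<open>card (D X) - 1\<close> new roots, because \<open>y\<close> is itself an old root.
        This -1 is the source of the factor exp (-r).\<close>
      have "S A \<subseteq> (\<Union>X\<in>A. D X - {y})" using y by (auto simp: S_def)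
      then have "card (S A) \<le> (\<Sum>X\<in>A. card (D X - {y}))"
        by (rule order_trans[OF card_mono card_UN_le, rotated])
           (use finA[OF A] A finY finD in auto)
      also have "\<dots> = (\<Sum>X\<in>A. card (D X) - 1)"
        by (rule sum.cong) (use A finD in \<open>auto simp: Y_def\<close>)
      finally have "(M * F) ^ card (S A) \<le> (M * F) ^ (\<Sum>X\<in>A. card (D X) - 1)"
        using M F mult_mono[of 1 M 1 F] by (intro power_increasing) auto
      then have "F ^ (card I - 1) * (?w A * (M * F) ^ card (S A)) \<le>
          F ^ (card I - 1) * (?w A * (M * F) ^ (\<Sum>X\<in>A. card (D X) - 1))"
        using F w by (intro mult_left_mono) auto
      then show "?w A * M ^ card (S A) * F ^ card (IA A) \<le>
          F ^ (card I - 1) * (\<Prod>X\<in>A. (exp (j X) - 1) * (M * F) ^ (card (D X) - 1))"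
        by (simp add: cIA[OF A] power_add power_mult_distrib prod.distrib power_sum mult_ac)
    qed
    also have "\<dots> = F ^ (card I - 1) * (\<Prod>X\<in>Y. (exp (j X) - 1) * (M * F) ^ (card (D X) - 1) + 1)"
      by (subst prod_add) (use finY in \<open>simp_all add: sum_distrib_left\<close>)
    also have "\<dots> \<le> F ^ (card I - 1) * (\<Prod>X\<in>Y. exp (j X * (M * F) ^ (card (D X) - 1)))"
    proof (intro mult_left_mono prod_mono conjI)
      fix X
      have "1 \<le> (M * F) ^ (card (D X) - 1)"
        using M F mult_mono[of 1 M 1 F] by (intro one_le_power) auto
      then show "(exp (j X) - 1) * (M * F) ^ (card (D X) - 1) + 1 \<le> exp (j X * (M * F) ^ (card (D X) - 1))"
        using one_plus_mult_exp_le[of "(M * F) ^ (card (D X) - 1)" "j X"]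
        by (simp add: mult.commute add.commute)
      show "0 \<le> (exp (j X) - 1) * (M * F) ^ (card (D X) - 1) + 1"
        using j[of X] M F by (intro add_nonneg_nonneg mult_nonneg_nonneg) auto
    qed (use F in auto)
    also have "\<dots> = F ^ (card I - 1) * exp (\<Sum>X\<in>Y. j X * (M * F) ^ (card (D X) - 1))"
      using finY by (simp add: exp_sum)
    also have "\<dots> \<le> F ^ (card I - 1) * exp (ln F)"
      using less.prems(3)[of y] F unfolding Y_def
      by (intro mult_left_mono iffD2[OF exp_le_cancel_iff]) auto
    also have "\<dots> = F ^ card I"
      using F False fin by (simp add: power_eq_if mult.commute)
    finally show ?thesis .
  qed
qed

subsection \<open>Hypergraph bounds for the weights\<close>

lemma links_connected_iff:
  "links_connected block X Y \<longleftrightarrow> image_set block X \<inter> image_set block Y \<noteq> {}"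
  by (auto simp: links_connected_def image_set_def)

text \<open>In a connected hypergraph the only nonempty closed part is the whole, so any block of
  its support can serve as the root.\<close>

lemma rooted_block_connected:
  assumes c: "block_connected block \<Gamma>" and y: "y \<in> image_support block \<Gamma>"
  shows "rooted_family (image_set block) {y} \<Gamma>"
  unfolding rooted_family_def
proof (intro allI impI)
  fix \<Gamma>1 assume \<Gamma>1: "\<Gamma>1 \<noteq> {}" "closed_part (image_set block) \<Gamma>1 \<Gamma>"
  have "\<Gamma>1 = \<Gamma>"
  proof (rule ccontr)
    assume "\<Gamma>1 \<noteq> \<Gamma>"
    then have "\<Gamma> - \<Gamma>1 \<noteq> {}" "\<Gamma>1 \<union> (\<Gamma> - \<Gamma>1) = \<Gamma>" "\<Gamma>1 \<inter> (\<Gamma> - \<Gamma>1) = {}"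
      "\<forall>X\<in>\<Gamma>1. \<forall>Y\<in>\<Gamma> - \<Gamma>1. \<not> links_connected block X Y"
      using \<Gamma>1(2) unfolding closed_part_def links_connected_iff by auto
    then show False using c \<Gamma>1(1) unfolding block_connected_def by metis
  qed
  then show "(\<Union>X\<in>\<Gamma>1. image_set block X) \<inter> {y} \<noteq> {}"
    using y by (auto simp: image_support_def)
qed

text \<open>Every nonempty closed part contains a minimal one, and minimality makes it connected: if
  it split, either half would be a smaller closed part. It is therefore a component, and components
  meet \<open>I\<close> by hypothesis.\<close>

lemma rooted_block_components:
  assumes fin: "finite \<Gamma>"
    and comp: "\<forall>\<Gamma>1\<in>block_components block \<Gamma>. image_support block \<Gamma>1 \<inter> I \<noteq> {}"
  shows "rooted_family (image_set block) I \<Gamma>"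
  unfolding rooted_family_def
proof (intro allI impI)
  let ?D = "image_set block"
  fix \<Gamma>1 assume \<Gamma>1: "\<Gamma>1 \<noteq> {}" "closed_part ?D \<Gamma>1 \<Gamma>"
  define Q where "Q = {\<Gamma>2. \<Gamma>2 \<subseteq> \<Gamma>1 \<and> \<Gamma>2 \<noteq> {} \<and> closed_part ?D \<Gamma>2 \<Gamma>}"
  have "finite \<Gamma>1" using \<Gamma>1(2) fin finite_subset by (auto simp: closed_part_def)
  then have "finite Q" by (rule finite_subset[rotated, OF finite_Pow_iff[THEN iffD2]]) (auto simp: Q_def)
  moreover have "\<Gamma>1 \<in> Q" using \<Gamma>1 by (auto simp: Q_def)
  ultimately obtain \<Gamma>2 where \<Gamma>2: "\<Gamma>2 \<in> Q" and min: "\<And>\<Gamma>3. \<Gamma>3 \<in> Q \<Longrightarrow> \<Gamma>3 \<subseteq> \<Gamma>2 \<Longrightarrow> \<Gamma>3 = \<Gamma>2"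
    using finite_has_minimal[of Q] by (metis empty_iff)
  have "block_connected block \<Gamma>2"
    unfolding block_connected_def
  proof (intro conjI notI)
    show "\<Gamma>2 = {} \<Longrightarrow> False" using \<Gamma>2 by (simp add: Q_def)
    assume "\<exists>\<Gamma>a \<Gamma>b. \<Gamma>a \<noteq> {} \<and> \<Gamma>b \<noteq> {} \<and> \<Gamma>a \<union> \<Gamma>b = \<Gamma>2 \<and> \<Gamma>a \<inter> \<Gamma>b = {} \<and>
      (\<forall>X\<in>\<Gamma>a. \<forall>Y\<in>\<Gamma>b. \<not> links_connected block X Y)"
    then obtain \<Gamma>a \<Gamma>b where ab: "\<Gamma>a \<noteq> {}" "\<Gamma>b \<noteq> {}" "\<Gamma>a \<union> \<Gamma>b = \<Gamma>2" "\<Gamma>a \<inter> \<Gamma>b = {}"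
      "\<forall>X\<in>\<Gamma>a. \<forall>Y\<in>\<Gamma>b. ?D X \<inter> ?D Y = {}"
      unfolding links_connected_iff not_not by (elim exE conjE)
    have "\<forall>X\<in>\<Gamma>a. \<forall>Y\<in>\<Gamma> - \<Gamma>a. ?D X \<inter> ?D Y = {}"
    proof (intro ballI)
      fix X Y assume "X \<in> \<Gamma>a" "Y \<in> \<Gamma> - \<Gamma>a"
      then show "?D X \<inter> ?D Y = {}"
      proof (cases "Y \<in> \<Gamma>b")
        case False
        then have "X \<in> \<Gamma>2" "Y \<in> \<Gamma> - \<Gamma>2" using ab(3) \<open>X \<in> \<Gamma>a\<close> \<open>Y \<in> \<Gamma> - \<Gamma>a\<close> by auto
        then show ?thesis using \<Gamma>2 by (simp add: Q_def closed_part_def)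
      qed (use ab(5) in simp)
    qed
    then have "\<Gamma>a \<in> Q" using ab \<Gamma>2 unfolding Q_def closed_part_def by auto
    then show False using min[of \<Gamma>a] ab by auto
  qed
  then have "\<Gamma>2 \<in> block_components block \<Gamma>"
    using \<Gamma>2 unfolding block_components_def Q_def closed_part_def links_connected_iff by auto
  then have "image_support block \<Gamma>2 \<inter> I \<noteq> {}" using comp by blast
  then show "(\<Union>X\<in>\<Gamma>1. ?D X) \<inter> I \<noteq> {}"
    using \<Gamma>2 by (auto simp: Q_def image_support_def)
qed

lemma image_set_finite:
  assumes bp: "block_partition block s" and X: "finite X"
  shows "finite (image_set block X)" "card (image_set block X) \<le> card X"
proof -
  obtain g where g: "\<And>x. x \<in> block (g x)" using block_partitionD(5)[OF bp] by metis
  have sub: "image_set block X \<subseteq> g ` X"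
  proof
    fix y assume "y \<in> image_set block X"
    then obtain x where x: "x \<in> block y" "x \<in> X" by (auto simp: image_set_def)
    then have "y = g x" using g[of x] block_partitionD(4)[OF bp, of y "g x"] by auto
    then show "y \<in> g ` X" using x by auto
  qed
  then show "finite (image_set block X)" using X finite_subset by blast
  show "card (image_set block X) \<le> card X"
    using card_mono[OF _ sub] card_image_le[OF X, of g] X by simp
qed

text \<open>A finite reservoir containing every hypergraph supported in \<open>N\<close>, so that
  the bound for finite link families applies.\<close>

definition links_in :: "('b \<Rightarrow> (int ^ 'd) set) \<Rightarrow> 'b set \<Rightarrow> (int ^ 'd) set set" where
  "links_in block N = {X. X \<noteq> {} \<and> X \<subseteq> (\<Union>y\<in>N. block y)}"

lemma finite_links_in:
  assumes bp: "block_partition block s" and N: "finite N"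
  shows "finite (links_in block N)" "X \<in> links_in block N \<Longrightarrow> finite X"
proof -
  have fin: "finite (\<Union>y\<in>N. block y)" using N block_partitionD(1)[OF bp] by auto
  show "finite (links_in block N)"
    by (rule finite_subset[OF _ finite_Pow_iff[THEN iffD2, OF fin]]) (auto simp: links_in_def)
  show "X \<in> links_in block N \<Longrightarrow> finite X"
    using fin finite_subset by (auto simp: links_in_def)
qed

lemma hypergraph_links_in:
  assumes bp: "block_partition block s" and "hypergraph \<Gamma>" "image_support block \<Gamma> \<subseteq> N"
  shows "\<Gamma> \<subseteq> links_in block N"
proof
  fix X assume X: "X \<in> \<Gamma>"
  have "x \<in> (\<Union>y\<in>N. block y)" if "x \<in> X" for x
  proof -
    obtain y where "x \<in> block y" using block_partitionD(5)[OF bp] by metis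
    then show ?thesis using that X assms(3) by (auto simp: image_support_def image_set_def)
  qed
  then show "X \<in> links_in block N" using X assms(2) by (auto simp: links_in_def hypergraph_def)
qed

definition family_weight :: "('x set \<Rightarrow> real) \<Rightarrow> 'x set set \<Rightarrow> real" where
  "family_weight J \<Gamma> = (\<Prod>X\<in>\<Gamma>. exp \<bar>J X\<bar> - 1)"

lemma family_weight_nonneg: "0 \<le> family_weight J \<Gamma>"
  unfolding family_weight_def by (intro prod_nonneg) auto

definition weight_bound ::
    "('b \<Rightarrow> (int ^ 'd) set) \<Rightarrow> ((int ^ 'd) set \<Rightarrow> real) \<Rightarrow> 'b set \<Rightarrow> real" where
  "weight_bound block J N =
     (\<Sum>\<Gamma> | hypergraph \<Gamma> \<and> block_connected block \<Gamma> \<and> image_support block \<Gamma> = N. family_weight J \<Gamma>)"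

definition marked_bound ::
    "('b \<Rightarrow> (int ^ 'd) set) \<Rightarrow> ((int ^ 'd) set \<Rightarrow> real) \<Rightarrow> (int ^ 'd) set \<Rightarrow> 'b set \<Rightarrow> real" where
  "marked_bound block J W R =
     (\<Sum>\<Gamma> | hypergraph \<Gamma> \<and> image_support block \<Gamma> = R \<and>
        (\<forall>\<Gamma>1\<in>block_components block \<Gamma>. image_support block \<Gamma>1 \<inter> image_set block W \<noteq> {}).
        family_weight J \<Gamma>)"

lemma abs_exp_minus_one_le: "\<bar>exp x - 1\<bar> \<le> exp \<bar>x\<bar> - (1::real)"
proof (cases "0 \<le> x")
  case False
  then have "1 \<le> exp (- x) * 1 \<and> exp x \<le> 1" by simp
  moreover have "exp x + exp (-x) \<ge> 2"
  proof -
    have "0 \<le> (exp (x/2) - exp (-x/2))\<^sup>2" by simp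
    also have "\<dots> = exp x + exp (-x) - 2"
      by (simp add: power2_diff flip: exp_double exp_add)
    finally show ?thesis by simp
  qed
  ultimately show ?thesis using False by simp
qed simp

lemma abs_prod_links_le:
  assumes s: "\<sigma> \<in> space spin_measure"
  shows "\<bar>\<Prod>X\<in>\<Gamma>. exp (J X * spin_prod \<sigma> X) - 1\<bar> \<le> family_weight J \<Gamma>"
  unfolding family_weight_def abs_prod
proof (intro prod_mono conjI)
  fix X
  have "\<bar>J X * spin_prod \<sigma> X\<bar> = \<bar>J X\<bar>" using spin_prod_pm1[OF s, of X] by (auto simp: abs_mult)
  then show "\<bar>exp (J X * spin_prod \<sigma> X) - 1\<bar> \<le> exp \<bar>J X\<bar> - 1"
    using abs_exp_minus_one_le[of "J X * spin_prod \<sigma> X"] by simp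
qed auto

lemma depends_on_prod_links:
  "depends_on (\<Union>\<Gamma>) (\<lambda>\<sigma>. \<Prod>X\<in>\<Gamma>. exp (J X * spin_prod \<sigma> X) - 1)"
proof -
  have "depends_on X (\<lambda>\<sigma>. exp (J X * spin_prod \<sigma> X) - 1)" for X
    by (rule depends_on_comp[OF depends_on_spin_prod, where g = "\<lambda>t. exp (J X * t) - 1"])
  then show ?thesis
    using depends_on_prod[of \<Gamma> "\<lambda>X. X" "\<lambda>X \<sigma>. exp (J X * spin_prod \<sigma> X) - 1"] by simp
qed

lemma abs_weight_le:
  assumes bp: "block_partition block s" and T: "rg_kernel block T" and s': "\<sigma>' \<in> space spin_measure"
    and N: "finite N"
  shows "\<bar>weight block T J \<sigma>' N\<bar> \<le> weight_bound block J N"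
  unfolding weight_def weight_bound_def
proof (rule order_trans[OF sum_abs sum_mono])
  fix \<Gamma> assume "\<Gamma> \<in> {\<Gamma>. hypergraph \<Gamma> \<and> block_connected block \<Gamma> \<and> image_support block \<Gamma> = N}"
  then have "finite (\<Union>\<Gamma>)" by (auto simp: hypergraph_def)
  then show "\<bar>\<integral>\<sigma>. (\<Prod>y\<in>N. T y \<sigma> (\<sigma>' y)) * (\<Prod>X\<in>\<Gamma>. exp (J X * spin_prod \<sigma> X) - 1) \<partial>spin_measure\<bar>
      \<le> family_weight J \<Gamma>"
    by (intro abs_integral_kernel_prod_le[OF bp T s' N depends_on_prod_links] abs_prod_links_le)
qed

lemma abs_marked_weight_le:
  assumes bp: "block_partition block s" and T: "rg_kernel block T" and s': "\<sigma>' \<in> space spin_measure"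
    and W: "finite W" and R: "finite R"
  shows "\<bar>marked_weight block T J W \<sigma>' R\<bar> \<le> marked_bound block J W R"
  unfolding marked_weight_def marked_bound_def
proof (rule order_trans[OF sum_abs sum_mono])
  fix \<Gamma> assume "\<Gamma> \<in> {\<Gamma>. hypergraph \<Gamma> \<and> image_support block \<Gamma> = R \<and>
        (\<forall>\<Gamma>1\<in>block_components block \<Gamma>. image_support block \<Gamma>1 \<inter> image_set block W \<noteq> {})}"
  then have fin: "finite (\<Union>\<Gamma>)" by (auto simp: hypergraph_def)
  let ?g = "\<lambda>\<sigma>. spin_prod \<sigma> W * (\<Prod>X\<in>\<Gamma>. exp (J X * spin_prod \<sigma> X) - 1)"
  have "\<bar>\<integral>\<sigma>. (\<Prod>y\<in>R \<union> image_set block W. T y \<sigma> (\<sigma>' y)) * ?g \<sigma> \<partial>spin_measure\<bar> \<le> family_weight J \<Gamma>"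
  proof (rule abs_integral_kernel_prod_le[OF bp T s'])
    show "finite (R \<union> image_set block W)" using R image_set_finite[OF bp W] by simp
    show "depends_on (W \<union> \<Union>\<Gamma>) ?g"
      by (rule depends_on_mult[OF depends_on_spin_prod depends_on_prod_links])
    show "finite (W \<union> \<Union>\<Gamma>)" using W fin by simp
    fix \<sigma> :: "int ^ 'b \<Rightarrow> real" assume \<sigma>: "\<sigma> \<in> space spin_measure"
    have "\<bar>spin_prod \<sigma> W\<bar> = 1" using spin_prod_pm1[OF \<sigma>, of W] by auto
    then show "\<bar>?g \<sigma>\<bar> \<le> family_weight J \<Gamma>"
      using abs_prod_links_le[OF \<sigma>, of J \<Gamma>] by (simp add: abs_mult)
  qed
  then show "\<bar>\<integral>\<sigma>. spin_prod \<sigma> W * (\<Prod>y\<in>R \<union> image_set block W. T y \<sigma> (\<sigma>' y)) *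
      (\<Prod>X\<in>\<Gamma>. exp (J X * spin_prod \<sigma> X) - 1) \<partial>spin_measure\<bar> \<le> family_weight J \<Gamma>"
    by (simp add: mult_ac)
qed

section \<open>Finite sums under the norm, and measurability of countable sums\<close>

lemma interaction_norm_sum_le:
  assumes norm: "interaction_norm r J \<le> ennreal K" and K: "0 \<le> K"
    and fin: "finite \<X>" and \<X>: "\<And>X. X \<in> \<X> \<Longrightarrow> finite X \<and> x \<in> X"
  shows "(\<Sum>X\<in>\<X>. \<bar>J X\<bar> * exp (r * real (card X))) \<le> K"
proof -
  let ?f = "\<lambda>X. ennreal (\<bar>J X\<bar> * exp (r * real (card X)))"
  have "ennreal (\<Sum>X\<in>\<X>. \<bar>J X\<bar> * exp (r * real (card X))) = infsum ?f \<X>"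
    using fin by (simp add: sum_ennreal)
  also have "\<dots> \<le> (\<Sum>\<^sub>\<infinity>X\<in>{X. finite X \<and> x \<in> X}. ?f X)"
    by (rule infsum_mono_neutral) (use \<X> in \<open>auto intro: nonneg_summable_on_complete\<close>)
  also have "\<dots> \<le> interaction_norm r J"
    unfolding interaction_norm_def by (rule SUP_upper) simp
  also note norm
  finally show ?thesis using K by (simp add: ennreal_le_iff)
qed

text \<open>Absolute summability makes the sum an integral against counting measure, which is
  sigma-finite on a countable set. Measurability in the parameter is then the usual statement about
  partial integration of a jointly measurable function.\<close>

lemma borel_measurable_infsum_real:
  fixes f :: "'i \<Rightarrow> 'w \<Rightarrow> real"
  assumes A: "countable A" and f: "\<And>i. i \<in> A \<Longrightarrow> f i \<in> borel_measurable M"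
    and abs: "\<And>w. w \<in> space M \<Longrightarrow> (\<lambda>i. \<bar>f i w\<bar>) summable_on A"
  shows "(\<lambda>w. \<Sum>\<^sub>\<infinity>i\<in>A. f i w) \<in> borel_measurable M"
proof -
  have eq: "(\<Sum>\<^sub>\<infinity>i\<in>A. f i w) = (\<integral>i. f i w \<partial>count_space A)" if "w \<in> space M" for w
  proof -
    have "(\<lambda>i. norm (f i w)) summable_on A" using abs[OF that] by simp
    then have "infsetsum (\<lambda>i. f i w) A = (\<Sum>\<^sub>\<infinity>i\<in>A. f i w)"
      by (intro infsetsum_infsum iffD1[OF abs_summable_equivalent])
    then show ?thesis by (simp add: infsetsum_def)
  qed
  interpret sigma_finite_measure "count_space A" by (rule sigma_finite_measure_count_space_countable[OF A])
  have "(\<lambda>(i, w). f i w) \<in> borel_measurable (count_space A \<Otimes>\<^sub>M M)"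
    by (rule measurable_pair_measure_countable1[OF A]) (simp add: f)
  from measurable_compose[OF measurable_pair_swap' this]
  have "(\<lambda>(w, i). f i w) \<in> borel_measurable (M \<Otimes>\<^sub>M count_space A)"
    by (simp add: case_prod_unfold)
  then have "(\<lambda>w. \<integral>i. f i w \<partial>count_space A) \<in> borel_measurable M"
    by (rule borel_measurable_lebesgue_integral)
  moreover have "(\<lambda>w. \<Sum>\<^sub>\<infinity>i\<in>A. f i w) \<in> borel_measurable M \<longleftrightarrow>
      (\<lambda>w. \<integral>i. f i w \<partial>count_space A) \<in> borel_measurable M"
    by (rule measurable_cong) (rule eq)
  ultimately show ?thesis by simp
qed

text \<open>The index type is arbitrary, but choosing a site in each of the disjoint nonempty blocks
  injects it into the countable original lattice.\<close>

lemma countable_blocks: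
  fixes block :: "'b \<Rightarrow> (int ^ 'd) set"
  assumes bp: "block_partition block s"
  shows "countable (A :: 'b set)"
proof -
  have "\<exists>x. x \<in> block y" for y using block_partitionD(2)[OF bp, of y] by auto
  then obtain g where g: "\<And>y. g y \<in> block y" by metis
  have "inj g"
  proof (rule injI)
    fix y z assume "g y = g z"
    then have "block y \<inter> block z \<noteq> {}" using g[of y] g[of z] by auto
    then show "y = z" using block_partitionD(4)[OF bp, of y z] by auto
  qed
  then have "countable (UNIV :: 'b set)" by (rule countableI')
  then show ?thesis by (rule countable_subset[rotated]) simp
qed

subsection \<open>Summability and measurability at high temperature\<close>

text \<open>In \<open>norm\<close>, \<open>F\<close> stands for $\exp(s\,\kappa\,e^{-r})$ with $\kappa$ the bound on the norm of \<open>J\<close>.\<close>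

locale high_temperature =
  fixes block :: "'b \<Rightarrow> (int ^ 'd) set" and s :: nat
    and T :: "'b \<Rightarrow> (int ^ 'd \<Rightarrow> real) \<Rightarrow> real \<Rightarrow> real"
    and J :: "(int ^ 'd) set \<Rightarrow> real" and r M F :: real
  assumes bp: "block_partition block s" and kernel: "rg_kernel block T"
    and M: "1 < M" and F: "1 \<le> F" and MF: "M * F \<le> exp r"
    and small: "M * (F - 1) \<le> ln M / 4"
    and norm: "interaction_norm r J \<le> ennreal (exp r * ln F / real s)"
begin

lemma s_pos: "0 < s"
  using block_partitionD(1-3)[OF bp] by (metis card_gt_0_iff)

text \<open>Since |X'| \<le> |X| and M F \<le> e^r, the power of \<open>M * F\<close> is at most
  e^{-r} e^{r|X|}. The norm bounds the sum through each of the s sites of the block, and the total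
  is exactly ln F.\<close>

lemma link_sum_le:
  assumes fin: "finite \<X>" and finX: "\<And>X. X \<in> \<X> \<Longrightarrow> finite X"
  shows "(\<Sum>X | X \<in> \<X> \<and> y \<in> image_set block X.
      \<bar>J X\<bar> * (M * F) ^ (card (image_set block X) - 1)) \<le> ln F"
proof -
  define Y where "Y = {X. X \<in> \<X> \<and> y \<in> image_set block X}"
  let ?f = "\<lambda>X. \<bar>J X\<bar> * exp (r * real (card X))"
  have finY: "finite Y" using fin by (simp add: Y_def)
  have MF1: "1 \<le> M * F" using M F mult_mono[of 1 M 1 F] by simp
  have bound: "\<bar>J X\<bar> * (M * F) ^ (card (image_set block X) - 1) \<le> exp (- r) * ?f X" if X: "X \<in> Y" for X
  proof -
    have fX: "finite X" "X \<noteq> {}" using X finX by (auto simp: Y_def image_set_def)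
    then have c: "1 \<le> card X" by (simp add: Suc_le_eq card_gt_0_iff)
    have "(M * F) ^ (card (image_set block X) - 1) \<le> (M * F) ^ (card X - 1)"
      using image_set_finite(2)[OF bp fX(1)] MF1 by (intro power_increasing) auto
    also have "\<dots> \<le> exp r ^ (card X - 1)" using MF MF1 by (intro power_mono) auto
    also have "\<dots> = exp (- r) * exp (r * real (card X))"
      using c by (simp add: exp_of_nat_mult[symmetric] exp_add[symmetric] of_nat_diff algebra_simps)
    finally have "\<bar>J X\<bar> * (M * F) ^ (card (image_set block X) - 1) \<le>
        \<bar>J X\<bar> * (exp (- r) * exp (r * real (card X)))" by (rule mult_left_mono) simp
    then show ?thesis by (simp add: mult_ac)
  qed
  have K: "0 \<le> exp r * ln F / real s" using F by simp
  have "(\<Sum>X\<in>Y. \<bar>J X\<bar> * (M * F) ^ (card (image_set block X) - 1)) \<le> (\<Sum>X\<in>Y. exp (- r) * ?f X)"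
    by (rule sum_mono[OF bound])
  also have "\<dots> = exp (- r) * (\<Sum>X\<in>Y. ?f X)" by (simp add: sum_distrib_left)
  \<comment> \<open>A link that meets the block in several sites is counted once for each of them,
    which only increases the bound.\<close>
  also have "(\<Sum>X\<in>Y. ?f X) \<le> (\<Sum>X\<in>Y. \<Sum>x\<in>block y. if x \<in> X then ?f X else 0)"
  proof (rule sum_mono)
    fix X assume "X \<in> Y"
    then obtain x where x: "x \<in> block y" "x \<in> X" by (auto simp: Y_def image_set_def)
    then have "?f X = (if x \<in> X then ?f X else 0)" by simp
    also have "\<dots> \<le> (\<Sum>x\<in>block y. if x \<in> X then ?f X else 0)"
      by (rule member_le_sum[OF x(1)]) (use block_partitionD(1)[OF bp] in auto)
    finally show "?f X \<le> (\<Sum>x\<in>block y. if x \<in> X then ?f X else 0)" .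
  qed
  also have "\<dots> = (\<Sum>x\<in>block y. \<Sum>X\<in>Y. if x \<in> X then ?f X else 0)" by (rule sum.swap)
  also have "\<dots> = (\<Sum>x\<in>block y. \<Sum>X | X \<in> Y \<and> x \<in> X. ?f X)"
    using finY by (simp add: sum.If_cases Int_def)
  also have "\<dots> \<le> (\<Sum>x\<in>block y. exp r * ln F / real s)"
  proof (intro sum_mono interaction_norm_sum_le[OF norm K])
    fix x
    show "finite {X. X \<in> Y \<and> x \<in> X}" using finY by (rule finite_subset[rotated]) auto
  qed (use finX in \<open>auto simp: Y_def\<close>)
  also have "\<dots> = exp r * ln F" using block_partitionD(3)[OF bp] s_pos by simp
  finally have "(\<Sum>X\<in>Y. \<bar>J X\<bar> * (M * F) ^ (card (image_set block X) - 1)) \<le> exp (- r) * (exp r * ln F)"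
    by simp
  also have "\<dots> = ln F" by (simp add: exp_minus)
  finally show ?thesis by (simp add: Y_def)
qed

lemma rooted_hypergraph_sum_le:
  assumes N: "finite N" and I: "finite I"
  shows "(\<Sum>\<Gamma> | \<Gamma> \<subseteq> links_in block N \<and> rooted_family (image_set block) I \<Gamma>.
      family_weight J \<Gamma> * M ^ card (image_support block \<Gamma> - I)) \<le> F ^ card I"
  unfolding family_weight_def image_support_def
  by (rule rooted_family_sum_le[OF _ F abs_ge_zero])
     (use M finite_links_in[OF bp N] image_set_finite[OF bp] I link_sum_le in auto)

lemma finite_rooted_hypergraphs:
  "finite N \<Longrightarrow> finite {\<Gamma>. \<Gamma> \<subseteq> links_in block N \<and> rooted_family (image_set block) I \<Gamma>}"
  by (rule finite_subset[of _ "Pow (links_in block N)"]) (auto simp: finite_links_in[OF bp])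

lemma finite_supported_hypergraphs:
  "finite N \<Longrightarrow> finite {\<Gamma>. hypergraph \<Gamma> \<and> Q \<Gamma> \<and> image_support block \<Gamma> = N}"
  by (rule finite_subset[of _ "Pow (links_in block N)"])
     (auto simp: finite_links_in[OF bp] dest!: hypergraph_links_in[OF bp, of _ N, OF _ equalityD1])

lemma weight_bound_nonneg: "0 \<le> weight_bound block J N"
  unfolding weight_bound_def by (intro sum_nonneg family_weight_nonneg)

text \<open>Root the hypergraphs at \<open>y\<close>. The rooted sum is at most \<open>F\<close> and
  includes 1 for the empty family, which is not block-connected; this leaves \<open>F - 1\<close>.
  The factor \<open>M\<close> pays for \<open>y\<close>, which the rooted sum does not
  weigh.\<close>

lemma weight_bound_sum_le:
  assumes P: "finite P" "\<And>N. N \<in> P \<Longrightarrow> finite N"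
  shows "(\<Sum>N | N \<in> P \<and> y \<in> N. weight_bound block J N * M ^ card N) \<le> M * (F - 1)"
proof -
  let ?U = "\<Union>P" and ?D = "image_set block" and ?fw = "family_weight J"
  define G where "G = {\<Gamma>. \<Gamma> \<subseteq> links_in block ?U \<and> rooted_family ?D {y} \<Gamma>}"
  define C where "C = (\<lambda>N. {\<Gamma>. hypergraph \<Gamma> \<and> block_connected block \<Gamma> \<and> image_support block \<Gamma> = N})"
  have U: "finite ?U" using P by auto
  have finG: "finite G" unfolding G_def by (rule finite_rooted_hypergraphs[OF U])
  have finC: "finite (C N)" if "N \<in> P" for N
    unfolding C_def by (rule finite_supported_hypergraphs) (use that P in auto)
  have empty: "{} \<in> G" by (auto simp: G_def rooted_family_def closed_part_def)
  have "(\<Sum>N | N \<in> P \<and> y \<in> N. weight_bound block J N * M ^ card N) =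
      (\<Sum>(N, \<Gamma>)\<in>(SIGMA N:{N. N \<in> P \<and> y \<in> N}. C N). ?fw \<Gamma> * M ^ card N)"
    by (subst sum.Sigma[symmetric])
       (use P finC in \<open>auto simp: weight_bound_def C_def sum_distrib_right\<close>)
  also have "\<dots> \<le> (\<Sum>\<Gamma>\<in>G - {{}}. M * (?fw \<Gamma> * M ^ card (image_support block \<Gamma> - {y})))"
  proof (rule sum_le_included[where i = "\<lambda>\<Gamma>. (image_support block \<Gamma>, \<Gamma>)"])
    show "\<forall>x\<in>SIGMA N:{N. N \<in> P \<and> y \<in> N}. C N. \<exists>\<Gamma>\<in>G - {{}}. (image_support block \<Gamma>, \<Gamma>) = x \<and>
        (case x of (N, \<Gamma>) \<Rightarrow> ?fw \<Gamma> * M ^ card N) \<le> M * (?fw \<Gamma> * M ^ card (image_support block \<Gamma> - {y}))"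
    proof
      fix x assume "x \<in> (SIGMA N:{N. N \<in> P \<and> y \<in> N}. C N)"
      then obtain N \<Gamma> where x: "x = (N, \<Gamma>)" and N: "N \<in> P" "y \<in> N" and \<Gamma>: "hypergraph \<Gamma>"
        "block_connected block \<Gamma>" "image_support block \<Gamma> = N" by (auto simp: C_def)
      have "\<Gamma> \<subseteq> links_in block ?U"
        by (rule hypergraph_links_in[OF bp \<Gamma>(1)]) (use \<Gamma> N in auto)
      moreover have "rooted_family ?D {y} \<Gamma>"
        by (rule rooted_block_connected[OF \<Gamma>(2)]) (use \<Gamma> N in simp)
      moreover have "\<Gamma> \<noteq> {}" using \<Gamma>(2) by (simp add: block_connected_def)
      ultimately have "\<Gamma> \<in> G - {{}}" by (simp add: G_def)
      moreover have "card N = Suc (card (N - {y}))" using N P by (intro card.remove) auto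
      then have "M ^ card N = M * M ^ card (N - {y})" by (simp only: power_Suc)
      then have "?fw \<Gamma> * M ^ card N = M * (?fw \<Gamma> * M ^ card (image_support block \<Gamma> - {y}))"
        using \<Gamma>(3) by simp
      ultimately show "\<exists>\<Gamma>\<in>G - {{}}. (image_support block \<Gamma>, \<Gamma>) = x \<and>
        (case x of (N, \<Gamma>) \<Rightarrow> ?fw \<Gamma> * M ^ card N) \<le> M * (?fw \<Gamma> * M ^ card (image_support block \<Gamma> - {y}))"
        using x \<Gamma> by (intro bexI[of _ \<Gamma>]) auto
    qed
  qed (use P finC finG M in \<open>auto intro!: mult_nonneg_nonneg family_weight_nonneg\<close>)
  also have "\<dots> = M * (\<Sum>\<Gamma>\<in>G - {{}}. ?fw \<Gamma> * M ^ card (image_support block \<Gamma> - {y}))"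
    by (simp add: sum_distrib_left)
  also have "(\<Sum>\<Gamma>\<in>G - {{}}. ?fw \<Gamma> * M ^ card (image_support block \<Gamma> - {y})) =
      (\<Sum>\<Gamma>\<in>G. ?fw \<Gamma> * M ^ card (image_support block \<Gamma> - {y})) - 1"
    using finG empty by (simp add: sum_diff1 family_weight_def image_support_def)
  also have "M * ((\<Sum>\<Gamma>\<in>G. ?fw \<Gamma> * M ^ card (image_support block \<Gamma> - {y})) - 1) \<le> M * (F - 1)"
    using rooted_hypergraph_sum_le[OF U, of "{y}"] M unfolding G_def
    by (intro mult_left_mono diff_right_mono) auto
  finally show ?thesis .
qed

text \<open>The same exploration, started from all blocks of W' at once. Here the empty family
  stays, as R = {} is allowed, and the unweighed roots cost one \<open>M\<close> each.\<close>

lemma marked_bound_sum_le: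
  assumes W: "finite W" and P: "finite P" "\<And>R. R \<in> P \<Longrightarrow> finite R"
  shows "(\<Sum>R\<in>P. marked_bound block J W R * M ^ card (R \<union> image_set block W)) \<le>
    (M * F) ^ card (image_set block W)"
proof -
  let ?U = "\<Union>P" and ?D = "image_set block" and ?W = "image_set block W" and ?fw = "family_weight J"
  define G where "G = {\<Gamma>. \<Gamma> \<subseteq> links_in block ?U \<and> rooted_family ?D ?W \<Gamma>}"
  define C where "C = (\<lambda>R. {\<Gamma>. hypergraph \<Gamma> \<and> image_support block \<Gamma> = R \<and>
    (\<forall>\<Gamma>1\<in>block_components block \<Gamma>. image_support block \<Gamma>1 \<inter> ?W \<noteq> {})})"
  have U: "finite ?U" and W': "finite ?W" using P image_set_finite[OF bp W] by auto
  have finG: "finite G" unfolding G_def by (rule finite_rooted_hypergraphs[OF U])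
  have finC: "finite (C R)" if "R \<in> P" for R
    by (rule finite_subset[OF _ finite_supported_hypergraphs[of R "\<lambda>_. True"]])
       (use that P in \<open>auto simp: C_def\<close>)
  have "(\<Sum>R\<in>P. marked_bound block J W R * M ^ card (R \<union> ?W)) =
      (\<Sum>(R, \<Gamma>)\<in>Sigma P C. ?fw \<Gamma> * M ^ card (R \<union> ?W))"
    by (subst sum.Sigma[symmetric])
       (use P finC in \<open>auto simp: marked_bound_def C_def sum_distrib_right\<close>)
  also have "\<dots> \<le> (\<Sum>\<Gamma>\<in>G. M ^ card ?W * (?fw \<Gamma> * M ^ card (image_support block \<Gamma> - ?W)))"
  proof (rule sum_le_included[where i = "\<lambda>\<Gamma>. (image_support block \<Gamma>, \<Gamma>)"])
    show "\<forall>x\<in>Sigma P C. \<exists>\<Gamma>\<in>G. (image_support block \<Gamma>, \<Gamma>) = x \<and>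
        (case x of (R, \<Gamma>) \<Rightarrow> ?fw \<Gamma> * M ^ card (R \<union> ?W)) \<le>
        M ^ card ?W * (?fw \<Gamma> * M ^ card (image_support block \<Gamma> - ?W))"
    proof
      fix x assume "x \<in> Sigma P C"
      then obtain R \<Gamma> where x: "x = (R, \<Gamma>)" and R: "R \<in> P" and \<Gamma>: "hypergraph \<Gamma>"
        "image_support block \<Gamma> = R"
        "\<forall>\<Gamma>1\<in>block_components block \<Gamma>. image_support block \<Gamma>1 \<inter> ?W \<noteq> {}"
        by (auto simp: C_def)
      have "\<Gamma> \<subseteq> links_in block ?U"
        by (rule hypergraph_links_in[OF bp \<Gamma>(1)]) (use \<Gamma> R in auto)
      moreover have "rooted_family ?D ?W \<Gamma>"
        by (rule rooted_block_components[OF _ \<Gamma>(3)]) (use \<Gamma>(1) in \<open>simp add: hypergraph_def\<close>)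
      ultimately have "\<Gamma> \<in> G" by (simp add: G_def)
      moreover have "card (R \<union> ?W) = card (?W \<union> (R - ?W))" by (simp add: Un_commute)
      then have "card (R \<union> ?W) = card ?W + card (R - ?W)"
        using W' P(2)[OF R] by (simp only: card_Un_disjoint Diff_disjoint finite_Diff)
      then have "?fw \<Gamma> * M ^ card (R \<union> ?W) = M ^ card ?W * (?fw \<Gamma> * M ^ card (image_support block \<Gamma> - ?W))"
        using \<Gamma> by (simp add: power_add)
      ultimately show "\<exists>\<Gamma>\<in>G. (image_support block \<Gamma>, \<Gamma>) = x \<and>
        (case x of (R, \<Gamma>) \<Rightarrow> ?fw \<Gamma> * M ^ card (R \<union> ?W)) \<le>
        M ^ card ?W * (?fw \<Gamma> * M ^ card (image_support block \<Gamma> - ?W))"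
        using x \<Gamma> by (intro bexI[of _ \<Gamma>]) auto
    qed
  qed (use P finC finG M in \<open>auto intro!: mult_nonneg_nonneg family_weight_nonneg\<close>)
  also have "\<dots> = M ^ card ?W * (\<Sum>\<Gamma>\<in>G. ?fw \<Gamma> * M ^ card (image_support block \<Gamma> - ?W))"
    by (simp add: sum_distrib_left)
  also have "\<dots> \<le> M ^ card ?W * F ^ card ?W"
    using rooted_hypergraph_sum_le[OF U W'] M unfolding G_def by (intro mult_left_mono) auto
  finally show ?thesis by (simp add: power_mult_distrib)
qed

section \<open>Convergence of the exponent\<close>

lemma exp_card_ln: "exp (real n * ln M) = M ^ n"
  using M by (simp add: exp_of_nat_mult)

text \<open>With a(N) = |N| ln M, the factor e^{a(N)} is the weight \<open>M ^ card N\<close>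
  already controlled at each site. A union bound over the sites of \<open>A\<close> gives the
  criterion.\<close>

lemma kotecky_preiss:
  assumes P: "finite P" "\<And>N. N \<in> P \<Longrightarrow> finite N" and A: "finite A"
  shows "(\<Sum>N\<in>P. overlap A N * weight_bound block J N * exp (real (card N) * ln M)) \<le>
    1 / 4 * (real (card A) * ln M)"
proof -
  let ?w = "\<lambda>N. weight_bound block J N * M ^ card N"
  have w: "0 \<le> ?w N" for N using weight_bound_nonneg[of N] M by simp
  have "(\<Sum>N\<in>P. overlap A N * weight_bound block J N * exp (real (card N) * ln M)) =
      (\<Sum>N\<in>P. overlap A N * ?w N)"
    by (simp only: exp_card_ln mult.assoc)
  also have "\<dots> \<le> (\<Sum>N\<in>P. \<Sum>y\<in>A. if y \<in> N then ?w N else 0)"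
  proof (rule sum_mono)
    fix N
    show "overlap A N * ?w N \<le> (\<Sum>y\<in>A. if y \<in> N then ?w N else 0)"
    proof (cases "A \<inter> N = {}")
      case True
      then show ?thesis using w[of N] by (simp add: overlap_def sum_nonneg)
    next
      case False
      then obtain y where y: "y \<in> A" "y \<in> N" by auto
      have "overlap A N * ?w N = (if y \<in> N then ?w N else 0)" using False y by (simp add: overlap_def)
      also have "\<dots> \<le> (\<Sum>y\<in>A. if y \<in> N then ?w N else 0)"
        by (rule member_le_sum[OF y(1)]) (use w A in auto)
      finally show ?thesis .
    qed
  qed
  also have "\<dots> = (\<Sum>y\<in>A. \<Sum>N\<in>P. if y \<in> N then ?w N else 0)" by (rule sum.swap)
  also have "\<dots> = (\<Sum>y\<in>A. \<Sum>N | N \<in> P \<and> y \<in> N. ?w N)"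
    using P(1) by (simp add: sum.If_cases Int_def)
  also have "\<dots> \<le> (\<Sum>y\<in>A. ln M / 4)"
    by (intro sum_mono order_trans[OF weight_bound_sum_le small] P)
  finally show ?thesis by simp
qed

text \<open>A finite set of indices fits into a box of orders up to \<open>q\<close> and polymers
  from a finite \<open>P\<close>. On the box the cluster bound applies to each order with \<theta> =
  1/4, its p! cancelling the prefactor.\<close>

lemma cluster_partial_sum_le:
  assumes s': "\<sigma>' \<in> space spin_measure" and A: "finite A"
    and K: "finite K" "K \<subseteq> (SIGMA p:{1..}. polymer_tuples p)"
  shows "(\<Sum>(p, N)\<in>K. \<bar>1 / fact p * cluster_term block T J \<sigma>' A p N\<bar>) \<le> real (card A) * ln M"
proof -
  let ?u = "weight_bound block J" and ?a = "\<lambda>N. real (card N) * ln M"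
  define P where "P = (\<Union>(p, N)\<in>K. N ` {1..p})"
  \<comment> \<open>The inserted 0 keeps \<open>Max\<close> meaningful for empty
    \<open>K\<close>.\<close>
  define q where "q = Max (insert 0 (fst ` K))"
  have P: "finite P" using K(1) by (auto simp: P_def)
  have finP: "finite N" if "N \<in> P" for N
    using that K(2) by (auto simp: P_def polymer_tuples_def PiE_iff)
  have sub: "K \<subseteq> (SIGMA p:{1..q}. {1..p} \<rightarrow>\<^sub>E P)"
  proof
    fix x assume x: "x \<in> K"
    obtain p N where pN: "x = (p, N)" by (cases x)
    have "p \<le> q" using K(1) x pN unfolding q_def by (intro Max_ge) force+
    moreover have "1 \<le> p" "N \<in> polymer_tuples p" using x pN K(2) by auto
    moreover have "N i \<in> P" if "i \<in> {1..p}" for i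
      using that x pN unfolding P_def by (intro UN_I[of x]) auto
    ultimately show "x \<in> (SIGMA p:{1..q}. {1..p} \<rightarrow>\<^sub>E P)"
      using pN by (auto simp: polymer_tuples_def PiE_iff)
  qed
  have finS: "finite (SIGMA p:{1..q}. {1..p} \<rightarrow>\<^sub>E P)"
    by (rule finite_SigmaI) (simp_all add: finite_PiE P)
  have u: "0 \<le> ?u N" for N using weight_bound_nonneg .
  have a: "0 \<le> ?a N" for N using M by simp
  have "(\<Sum>(p, N)\<in>K. \<bar>1 / fact p * cluster_term block T J \<sigma>' A p N\<bar>) \<le>
      (\<Sum>(p, N)\<in>(SIGMA p:{1..q}. {1..p} \<rightarrow>\<^sub>E P). \<bar>1 / fact p * cluster_term block T J \<sigma>' A p N\<bar>)"
    by (rule sum_mono2[OF finS sub]) auto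
  also have "\<dots> = (\<Sum>p=1..q. \<Sum>N\<in>{1..p} \<rightarrow>\<^sub>E P. \<bar>1 / fact p * cluster_term block T J \<sigma>' A p N\<bar>)"
    by (subst sum.Sigma[symmetric]) (simp_all add: finite_PiE P)
  also have "\<dots> \<le> (\<Sum>p=1..q. (1 / 4) ^ p * ?a A)"
  proof (rule sum_mono)
    fix p assume p: "p \<in> {1..q}"
    have "(\<Sum>N\<in>{1..p} \<rightarrow>\<^sub>E P. \<bar>1 / fact p * cluster_term block T J \<sigma>' A p N\<bar>) \<le>
      (\<Sum>N\<in>{1..p} \<rightarrow>\<^sub>E P. 1 / fact p *
        (\<bar>cluster_coeff p N\<bar> * overlap A (\<Union>i\<in>{1..p}. N i) * (\<Prod>i=1..p. ?u (N i))))"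
    proof (rule sum_mono)
      fix N assume N: "N \<in> {1..p} \<rightarrow>\<^sub>E P"
      have "\<bar>\<Prod>i=1..p. weight block T J \<sigma>' (N i)\<bar> \<le> (\<Prod>i=1..p. ?u (N i))"
        unfolding abs_prod
        by (intro prod_mono conjI abs_ge_zero abs_weight_le[OF bp kernel s'] finP)
           (use N in \<open>auto simp: PiE_iff\<close>)
      moreover have "0 \<le> overlap A (\<Union>i\<in>{1..p}. N i)" by (simp add: overlap_def)
      ultimately show "\<bar>1 / fact p * cluster_term block T J \<sigma>' A p N\<bar> \<le> 1 / fact p *
        (\<bar>cluster_coeff p N\<bar> * overlap A (\<Union>i\<in>{1..p}. N i) * (\<Prod>i=1..p. ?u (N i)))"
        unfolding cluster_term_def abs_mult
        by (simp add: divide_right_mono mult_left_mono)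
    qed
    also have "\<dots> = 1 / fact p * (\<Sum>N\<in>{1..p} \<rightarrow>\<^sub>E P.
        \<bar>cluster_coeff p N\<bar> * overlap A (\<Union>i\<in>{1..p}. N i) * (\<Prod>i=1..p. ?u (N i)))"
      by (simp only: sum_distrib_left)
    also have "\<dots> \<le> 1 / fact p * (fact p * (1 / 4) ^ p * ?a A)"
    proof (intro mult_left_mono cluster_sum_bound[OF u a _ P])
      show "(\<Sum>y\<in>P. overlap x y * ?u y * exp (?a y)) \<le> 1 / 4 * ?a x" if "x \<in> insert A P" for x
        by (rule kotecky_preiss[OF P finP]) (use that A finP in auto)
    qed (use p in auto)
    finally show "(\<Sum>N\<in>{1..p} \<rightarrow>\<^sub>E P. \<bar>1 / fact p * cluster_term block T J \<sigma>' A p N\<bar>) \<le>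
        (1 / 4) ^ p * ?a A" by simp
  qed
  also have "\<dots> = (\<Sum>p=1..q. (1 / 4 :: real) ^ p) * ?a A" by (simp only: sum_distrib_right)
  also have "\<dots> \<le> 1 * ?a A"
  proof (rule mult_right_mono[OF _ a])
    \<comment> \<open>Sharper than the bound by 1 that is wanted, so that the induction
      closes.\<close>
    have "(\<Sum>p=1..q. (1 / 4 :: real) ^ p) \<le> 1 - (1 / 4) ^ q"
    proof (induction q)
      case (Suc q)
      have "(\<Sum>p=1..Suc q. (1 / 4 :: real) ^ p) = (\<Sum>p=1..q. (1 / 4) ^ p) + 1 / 4 * (1 / 4) ^ q" by simp
      then show ?case using Suc zero_le_power[of "1 / 4 :: real" q] unfolding power_Suc by linarith
    qed simp
    also have "\<dots> \<le> 1" by simp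
    finally show "(\<Sum>p=1..q. (1 / 4 :: real) ^ p) \<le> 1" .
  qed
  finally show ?thesis by simp
qed

lemma exponent_converges:
  assumes s': "\<sigma>' \<in> space spin_measure" and A: "finite A"
  shows "exponent_converges block T J \<sigma>' A"
  unfolding exponent_converges_def
proof (rule nonneg_bdd_above_summable_on)
  show "bdd_above (sum (\<lambda>(p, N). \<bar>1 / fact p * cluster_term block T J \<sigma>' A p N\<bar>) `
      {K. K \<subseteq> (SIGMA p:{1..}. polymer_tuples p) \<and> finite K})"
    by (rule bdd_aboveI2[where M = "real (card A) * ln M"], rule cluster_partial_sum_le[OF s' A]) auto
qed auto

text \<open>Absolute convergence merges the iterated sum into one sum over a countable set of pairs,
  the form in which it can be both estimated and shown to be measurable.\<close>

lemma partition_ratio_eq: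
  assumes s': "\<sigma>' \<in> space spin_measure" and A: "finite A"
  shows "partition_ratio block T J \<sigma>' A = exp (- (\<Sum>\<^sub>\<infinity>(p, N)\<in>(SIGMA p:{1..}. polymer_tuples p).
    1 / fact p * cluster_term block T J \<sigma>' A p N))"
proof -
  have "(\<lambda>x. norm (case x of (p, N) \<Rightarrow> 1 / fact p * cluster_term block T J \<sigma>' A p N))
      summable_on (SIGMA p:{1..}. polymer_tuples p)"
    using exponent_converges[OF s' A] unfolding exponent_converges_def
    by (simp add: case_prod_unfold)
  then have "(\<lambda>x. case x of (p, N) \<Rightarrow> 1 / fact p * cluster_term block T J \<sigma>' A p N)
      summable_on (SIGMA p:{1..}. polymer_tuples p)"
    by (rule abs_summable_summable)
  from infsum_Sigma'_banach[OF this] show ?thesis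
    unfolding partition_ratio_def by (simp only: infsum_cmult_right')
qed

lemma partition_ratio_le:
  assumes s': "\<sigma>' \<in> space spin_measure" and A: "finite A"
  shows "partition_ratio block T J \<sigma>' A \<le> M ^ card A"
proof -
  let ?S = "SIGMA p:{1..}. polymer_tuples p"
  let ?f = "\<lambda>x. case x of (p, N) \<Rightarrow> 1 / fact p * cluster_term block T J \<sigma>' A p N"
  have abs: "(\<lambda>x. norm (?f x)) summable_on ?S"
    using exponent_converges[OF s' A] unfolding exponent_converges_def
    by (simp add: case_prod_unfold)
  have "\<bar>infsum ?f ?S\<bar> \<le> (\<Sum>\<^sub>\<infinity>x\<in>?S. norm (?f x))"
    using norm_infsum_bound[OF abs] by simp
  also have "\<dots> \<le> real (card A) * ln M"
    using cluster_partial_sum_le[OF s' A]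
    by (intro infsum_le_finite_sums[OF abs]) (simp add: case_prod_unfold)
  finally have "exp (- infsum ?f ?S) \<le> exp (real (card A) * ln M)" by simp
  then show ?thesis unfolding partition_ratio_eq[OF s' A] exp_card_ln .
qed

lemma rg_term_partial_sum_le:
  assumes s': "\<sigma>' \<in> space spin_measure" and W: "finite W" and P: "finite P" "P \<subseteq> marked_sets block W"
  shows "(\<Sum>R\<in>P. \<bar>rg_term block T J W \<sigma>' R\<bar>) \<le> (M * F) ^ card (image_set block W)"
proof -
  have finP: "finite R" if "R \<in> P" for R using that P by (auto simp: marked_sets_def)
  have "(\<Sum>R\<in>P. \<bar>rg_term block T J W \<sigma>' R\<bar>) \<le>
      (\<Sum>R\<in>P. marked_bound block J W R * M ^ card (R \<union> image_set block W))"
  proof (rule sum_mono)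
    fix R assume "R \<in> P"
    then have R: "finite R" by (rule finP)
    then have "finite (R \<union> image_set block W)" using image_set_finite[OF bp W] by simp
    from partition_ratio_le[OF s' this] abs_marked_weight_le[OF bp kernel s' W R, of J]
    show "\<bar>rg_term block T J W \<sigma>' R\<bar> \<le> marked_bound block J W R * M ^ card (R \<union> image_set block W)"
      unfolding rg_term_def abs_mult
      by (intro mult_mono) (auto simp: partition_ratio_def)
  qed
  also have "\<dots> \<le> (M * F) ^ card (image_set block W)"
    by (rule marked_bound_sum_le[OF W P(1) finP])
  finally show ?thesis .
qed

lemma rg_term_summable:
  assumes s': "\<sigma>' \<in> space spin_measure" and W: "finite W"
  shows "(\<lambda>R. \<bar>rg_term block T J W \<sigma>' R\<bar>) summable_on marked_sets block W"
  by (rule nonneg_bdd_above_summable_on, simp,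
      rule bdd_aboveI2[where M = "(M * F) ^ card (image_set block W)"],
      rule rg_term_partial_sum_le[OF s' W]) auto

lemma abs_rg_sum_le:
  assumes s': "\<sigma>' \<in> space spin_measure" and W: "finite W"
  shows "\<bar>\<Sum>\<^sub>\<infinity>R\<in>marked_sets block W. rg_term block T J W \<sigma>' R\<bar> \<le> (M * F) ^ card (image_set block W)"
proof -
  have abs: "(\<lambda>R. norm (rg_term block T J W \<sigma>' R)) summable_on marked_sets block W"
    using rg_term_summable[OF s' W] by simp
  have "\<bar>\<Sum>\<^sub>\<infinity>R\<in>marked_sets block W. rg_term block T J W \<sigma>' R\<bar> \<le>
      (\<Sum>\<^sub>\<infinity>R\<in>marked_sets block W. norm (rg_term block T J W \<sigma>' R))"
    using norm_infsum_bound[OF abs] by simp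
  also have "\<dots> \<le> (M * F) ^ card (image_set block W)"
    using rg_term_partial_sum_le[OF s' W]
    by (intro infsum_le_finite_sums[OF abs]) simp
  finally show ?thesis .
qed

section \<open>Measurability and integrability in the image configuration\<close>

lemma countable_finite_subsets: "countable {A :: 'b set. finite A}"
  using countable_Collect_finite_subset[OF countable_blocks[OF bp, of UNIV]] by simp

text \<open>Only the image spins in \<open>N\<close> enter, so the weight is a cylinder function of
  \<open>\<sigma>'\<close>.\<close>

lemma weight_measurable:
  assumes N: "finite N"
  shows "(\<lambda>\<sigma>'. weight block T J \<sigma>' N) \<in> borel_measurable spin_measure"
proof (rule depends_on_measurable[OF _ N])
  show "depends_on N (\<lambda>\<sigma>'. weight block T J \<sigma>' N)"
    unfolding depends_on_def
  proof (intro ballI impI)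
    fix \<sigma> \<tau> :: "'b \<Rightarrow> real" assume "\<forall>x\<in>N. \<sigma> x = \<tau> x"
    then have "(\<Prod>y\<in>N. T y \<rho> (\<sigma> y)) = (\<Prod>y\<in>N. T y \<rho> (\<tau> y))" for \<rho> by (intro prod.cong) auto
    then show "weight block T J \<sigma> N = weight block T J \<tau> N" by (simp add: weight_def)
  qed
qed

lemma marked_weight_measurable:
  assumes R: "finite R" and W: "finite W"
  shows "(\<lambda>\<sigma>'. marked_weight block T J W \<sigma>' R) \<in> borel_measurable spin_measure"
proof (rule depends_on_measurable)
  let ?A = "R \<union> image_set block W"
  show "depends_on ?A (\<lambda>\<sigma>'. marked_weight block T J W \<sigma>' R)"
    unfolding depends_on_def
  proof (intro ballI impI)
    fix \<sigma> \<tau> :: "'b \<Rightarrow> real" assume "\<forall>x\<in>?A. \<sigma> x = \<tau> x"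
    then have "(\<Prod>y\<in>?A. T y \<rho> (\<sigma> y)) = (\<Prod>y\<in>?A. T y \<rho> (\<tau> y))" for \<rho> by (intro prod.cong) auto
    then show "marked_weight block T J W \<sigma> R = marked_weight block T J W \<tau> R"
      by (simp add: marked_weight_def)
  qed
  show "finite ?A" using R image_set_finite[OF bp W] by simp
qed

lemma partition_ratio_measurable:
  assumes A: "finite A"
  shows "(\<lambda>\<sigma>'. partition_ratio block T J \<sigma>' A) \<in> borel_measurable spin_measure"
proof -
  let ?S = "(SIGMA p:{1..}. polymer_tuples p) :: (nat \<times> (nat \<Rightarrow> 'b set)) set"
  let ?f = "\<lambda>x \<sigma>'. case x of (p, N) \<Rightarrow> 1 / fact p * cluster_term block T J \<sigma>' A p N"
  have "countable {N :: 'b set. finite N \<and> N \<noteq> {}}"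
    by (rule countable_subset[OF _ countable_finite_subsets]) auto
  then have "countable (polymer_tuples p :: (nat \<Rightarrow> 'b set) set)" for p
    unfolding polymer_tuples_def by (intro countable_PiE) auto
  then have "countable ?S" by (intro countable_SIGMA) auto
  moreover have "?f x \<in> borel_measurable spin_measure" if x: "x \<in> ?S" for x
  proof -
    obtain p N where pN: "x = (p, N)" "N \<in> polymer_tuples p" using x by auto
    then have "(\<lambda>\<sigma>'. weight block T J \<sigma>' (N i)) \<in> borel_measurable spin_measure" if "i \<in> {1..p}" for i
      using that by (intro weight_measurable) (auto simp: polymer_tuples_def PiE_iff)
    then have "(\<lambda>\<sigma>'. \<Prod>i=1..p. weight block T J \<sigma>' (N i)) \<in> borel_measurable spin_measure"
      by (rule borel_measurable_prod)
    then show ?thesis unfolding pN(1) prod.case cluster_term_def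
      by (intro borel_measurable_times borel_measurable_const)
  qed
  moreover have "(\<lambda>x. \<bar>?f x \<sigma>'\<bar>) summable_on ?S" if "\<sigma>' \<in> space spin_measure" for \<sigma>'
    using exponent_converges[OF that A] unfolding exponent_converges_def
    by (simp add: case_prod_unfold)
  ultimately have "(\<lambda>\<sigma>'. \<Sum>\<^sub>\<infinity>x\<in>?S. ?f x \<sigma>') \<in> borel_measurable spin_measure"
    by (rule borel_measurable_infsum_real)
  then have "(\<lambda>\<sigma>'. exp (- (\<Sum>\<^sub>\<infinity>x\<in>?S. ?f x \<sigma>'))) \<in> borel_measurable spin_measure"
    by - (rule measurable_compose[OF borel_measurable_uminus borel_measurable_exp])
  moreover have "(\<lambda>\<sigma>'. partition_ratio block T J \<sigma>' A) \<in> borel_measurable spin_measure \<longleftrightarrow>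
      (\<lambda>\<sigma>'. exp (- (\<Sum>\<^sub>\<infinity>x\<in>?S. ?f x \<sigma>'))) \<in> borel_measurable spin_measure"
    by (rule measurable_cong) (rule partition_ratio_eq[OF _ A])
  ultimately show ?thesis by simp
qed

lemma rg_derivative_integrable:
  assumes W: "finite W" and Z: "finite Z"
  shows "integrable spin_measure (rg_derivative_integrand block T J W Z)"
proof -
  interpret prob_space "spin_measure :: ('b \<Rightarrow> real) measure" by (rule prob_space_spin)
  let ?I = "\<lambda>\<sigma>'. \<Sum>\<^sub>\<infinity>R\<in>marked_sets block W. rg_term block T J W \<sigma>' R"
  have "?I \<in> borel_measurable spin_measure"
  proof (rule borel_measurable_infsum_real)
    show "countable (marked_sets block W)"
      by (rule countable_subset[OF _ countable_finite_subsets]) (auto simp: marked_sets_def)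
    fix R assume "R \<in> marked_sets block W"
    then have R: "finite R" by (simp add: marked_sets_def)
    show "(\<lambda>\<sigma>'. rg_term block T J W \<sigma>' R) \<in> borel_measurable spin_measure"
      unfolding rg_term_def
      by (intro borel_measurable_times marked_weight_measurable[OF R W] partition_ratio_measurable)
         (use R image_set_finite[OF bp W] in auto)
  qed (rule rg_term_summable[OF _ W])
  then have "rg_derivative_integrand block T J W Z \<in> borel_measurable spin_measure"
    unfolding rg_derivative_integrand_def
    by (intro borel_measurable_times depends_on_measurable[OF depends_on_spin_prod Z])
  moreover have "norm (rg_derivative_integrand block T J W Z \<sigma>') \<le> (M * F) ^ card (image_set block W)"
    if s': "\<sigma>' \<in> space spin_measure" for \<sigma>'
  proof -
    have "\<bar>spin_prod \<sigma>' Z\<bar> = 1" using spin_prod_pm1[OF s', of Z] by auto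
    then show ?thesis using abs_rg_sum_le[OF s' W]
      by (simp add: rg_derivative_integrand_def abs_mult)
  qed
  ultimately show ?thesis
    by (intro integrable_const_bound[where B = "(M * F) ^ card (image_set block W)"] AE_I2)
qed

lemma rg_derivative_well_defined:
  assumes W: "finite W" and Z: "finite Z"
  shows "rg_derivative_well_defined block T J W Z"
  unfolding rg_derivative_well_defined_def
  using rg_derivative_integrable[OF W Z] rg_term_summable[OF _ W] exponent_converges
    image_set_finite(1)[OF bp W]
  by (auto simp: marked_sets_def)

end

section \<open>The numerical content of the high temperature condition\<close>

theorem theorem3p6:
  fixes block :: "'b \<Rightarrow> (int ^ 'd) set"
    and s :: nat
    and T :: "'b \<Rightarrow> (int ^ 'd \<Rightarrow> real) \<Rightarrow> real \<Rightarrow> real"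
    and J :: "(int ^ 'd) set \<Rightarrow> real"
    and r M \<epsilon> c :: real
  assumes "block_partition block s"
    and "rg_kernel block T"
    and "r > 0" and "1 < M" and "M < exp r"
    and "\<epsilon> = M * exp (- r)"
    and "c = 1 / sqrt \<epsilon> - 1"
    and "J \<in> interaction_space r"
    and "interaction_norm r J \<le> ennreal (ln M * c\<^sup>2 / (2 * real s * (c + ln M)))"
  shows "\<forall>W Z. finite W \<longrightarrow> finite Z \<longrightarrow> rg_derivative_well_defined block T J W Z"
proof (intro allI impI)
  fix W :: "(int ^ 'd) set" and Z :: "'b set" assume W: "finite W" and Z: "finite Z"
  \<comment> \<open>This is s \<kappa> e^{-r}, with s cancelled against the denominator of \<kappa>;
    \<open>exp u\<close> will be \<open>F\<close>.\<close>
  define u where "u = ln M * c\<^sup>2 / (2 * (c + ln M)) * exp (- r)"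
  have L: "0 < ln M" "ln M \<le> M" using \<open>1 < M\<close> ln_le_minus_one[of M] by auto
  have \<epsilon>: "0 < \<epsilon>" "\<epsilon> < 1"
    using assms(4,5) unfolding assms(6) by (simp_all add: exp_minus field_simps)
  have c1: "1 + c = 1 / sqrt \<epsilon>" using assms(7) by simp
  have "sqrt \<epsilon> < 1" "0 < sqrt \<epsilon>" using \<epsilon> by simp_all
  then have "1 < 1 / sqrt \<epsilon>" by (simp only: less_divide_eq_1_pos)
  then have c: "0 < c" using assms(7) by simp
  have "(1 + c)\<^sup>2 = 1 / \<epsilon>" using \<epsilon> by (simp add: c1 power_divide)
  then have er: "exp r = M * (1 + c)\<^sup>2"
    using \<open>1 < M\<close> by (simp add: assms(6) exp_minus field_simps)
  \<comment> \<open>The arithmetic-geometric mean inequality. Doubled by exp u - 1 \<le> 2u, this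
    1/8 becomes the 1/4 of the criterion.\<close>
  have "c / (2 * (1 + c)\<^sup>2) \<le> 1 / 8"
  proof -
    have "0 \<le> (1 - c)\<^sup>2" by simp
    then have "4 * c \<le> (1 + c)\<^sup>2" by (simp add: power2_eq_square algebra_simps)
    then show ?thesis using c by (simp add: field_simps)
  qed
  moreover have "c\<^sup>2 / (c + ln M) \<le> c"
  proof (rule mult_imp_div_pos_le)
    show "c\<^sup>2 \<le> c * (c + ln M)"
      using mult_pos_pos[OF c L(1)] unfolding power2_eq_square distrib_left by linarith
  qed (use c L in linarith)
  then have "c\<^sup>2 / (c + ln M) / (2 * (1 + c)\<^sup>2) \<le> c / (2 * (1 + c)\<^sup>2)"
    by (rule divide_right_mono) simp
  ultimately have q: "c\<^sup>2 / (c + ln M) / (2 * (1 + c)\<^sup>2) \<le> 1 / 8"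
    "c\<^sup>2 / (c + ln M) / (2 * (1 + c)\<^sup>2) \<le> c / (2 * (1 + c)\<^sup>2)" by linarith+
  \<comment> \<open>The factor M in e^r = M (1 + c)^2 cancels the one in front of
    \<open>u\<close>.\<close>
  have Mu: "M * u = ln M * (c\<^sup>2 / (c + ln M) / (2 * (1 + c)\<^sup>2))"
  proof -
    have "exp (- r) = 1 / (M * (1 + c)\<^sup>2)" by (simp add: exp_minus er inverse_eq_divide)
    moreover have "M * (L * a / (2 * D) * (1 / (M * b))) = L * (a / D / (2 * b))" for L a b D
      using \<open>1 < M\<close> by (auto simp: divide_simps)
    ultimately show ?thesis by (simp only: u_def)
  qed
  have u0: "0 \<le> u"
    unfolding u_def using c \<open>1 < M\<close> by (intro mult_nonneg_nonneg divide_nonneg_nonneg) auto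
  have Mu8: "M * u \<le> ln M / 8"
    using mult_left_mono[OF q(1) less_imp_le[OF L(1)]] unfolding Mu by linarith
  have "M * u \<le> M * (c / (2 * (1 + c)\<^sup>2))"
    unfolding Mu using L q(2) c by (intro mult_mono) auto
  then have uc: "u \<le> c / (2 * (1 + c)\<^sup>2)"
    by (rule mult_left_le_imp_le) (use \<open>1 < M\<close> in simp)
  then have u1: "u \<le> 1" using \<open>c / (2 * (1 + c)\<^sup>2) \<le> 1 / 8\<close> by linarith
  \<comment> \<open>From exp u \<le> 1 + u + u^2 on [0,1].\<close>
  have "u\<^sup>2 \<le> u" using u0 u1 by (simp add: power2_eq_square mult_left_le)
  with exp_bound[OF u0 u1] have eu: "exp u \<le> 1 + 2 * u" by linarith
  interpret high_temperature block s T J r M "exp u"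
  proof
    show "M * exp u \<le> exp r"
    proof -
      \<comment> \<open>The aim is F \<le> 1 + c \<le> (1 + c)^2, the last square being e^r /
        M.\<close>
      have "2 * u \<le> c / (1 + c)\<^sup>2" using uc by simp
      also have "\<dots> \<le> c"
        using c mult_left_mono[of 1 "(1 + c)\<^sup>2" c]
        by (intro mult_imp_div_pos_le) (auto intro: one_le_power)
      finally have "exp u \<le> 1 + c" using eu by linarith
      also have "\<dots> \<le> (1 + c)\<^sup>2" using c by (simp add: power2_eq_square)
      finally show ?thesis unfolding er using \<open>1 < M\<close> by simp
    qed
    have "M * (exp u - 1) \<le> M * (2 * u)" using eu \<open>1 < M\<close> by (intro mult_left_mono) auto
    then show "M * (exp u - 1) \<le> ln M / 4" using Mu8 by linarith
    have "exp r * ln (exp u) / real s = ln M * c\<^sup>2 / (2 * real s * (c + ln M))"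
    proof -
      have "exp r * u = ln M * c\<^sup>2 / (2 * (c + ln M))" by (simp add: u_def exp_minus)
      then show ?thesis by (simp add: mult_ac)
    qed
    then show "interaction_norm r J \<le> ennreal (exp r * ln (exp u) / real s)"
      using assms(9) by simp
  qed (use assms(1,2,4) u0 in auto)
  show "rg_derivative_well_defined block T J W Z"
    by (rule rg_derivative_well_defined[OF W Z])
qed
end
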